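(* Let $n \geq 2$ and $0 \leq k \leq n/2$ be integers, and let $\mathcal{B}_{n,k}$ be the set of positive $k$-roots with no defects. Then: (i) The labelling function $\lambda : \mathcal{B}_{n,k} \to \Lambda_{n,k}$ is a bijection. (ii) The set $\mathcal{B}_{n,k}$ is a basis for $V_{n,k}$ over $\mathbb{Q}$. (iii) Every positive $k$-root is a linear combination of elements of $\mathcal{B}_{n,k}$ with nonnegative integer coefficients. (iv) The elements of $\mathcal{B}_{n,k}$ are the only positive $k$-roots that cannot be written as positive linear combinations of other positive $k$-roots.
   Context: $V_{n,k}$ is the $\mathbb{Q}$-vector space with basis the set of squarefree monomials $x_I=\prod_{i\in I}x_i$ of degree $k$ in commuting indeterminates $x_1,\dots,x_n$ ($I\subseteq\{1,\dots,n\}$, $|I|=k$). Order these monomials lexicographically: for distinct $I,J$, let $t$ be the smallest element of the symmetric difference $I\,\Delta\,J$; then $x_I \prec x_J$ if $t\in I$. A nonzero $v\in V_{n,k}$ is positive ($v>0$) if the $\prec$-minimal monomial appearing in $v$ has positive coefficient, negative otherwise. A $k$-root is an element of $V_{n,k}$ of the form $\prod_{r=1}^k(\pm x_{i_{2r-1}}\pm x_{i_{2r}})$, with signs chosen independently and $i_1,\dots,i_{2k}$ distinct indices in $\{1,\dots,n\}$; it is positive if it is $>0$. Every positive $k$-root can be written as $\prod_{r=1}^k(x_{i_{2r-1}}\pm x_{i_{2r}})$ with $i_{2r-1}<i_{2r}$ for all $r$, uniquely up to reordering the factors (its normal form). In the normal form, a factor $(x_i-x_j)$ ($i<j$) is antisymmetric,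 a factor $(x_i+x_j)$ is symmetric, and an index not appearing in any factor is unused. A positive $k$-root has a defect if its normal form has one of the following, where $i<j<r<s$: (i) two factors $(x_i\pm x_r)$ and $(x_j\pm x_s)$; (ii) a factor $(x_i\pm x_s)$ and a symmetric factor $(x_j+x_r)$; (iii) a factor $(x_i\pm x_r)$ and an unused index $j$; (iv) a symmetric factor $(x_i+x_j)$ and an unused index $r$. For $\alpha\in\mathcal{B}_{n,k}$, its label $\lambda(\alpha)$ is the word of length $n$ over $\{1,2\}$ with $\lambda(\alpha)_j=2$ iff the normal form of $\alpha$ has a factor $(x_i-x_j)$ for some $i<j$. $\Lambda_{n,k}$ is the set of lattice words of length $n$ over $\{1,2\}$ (every initial segment contains at least as many 1s as 2s) with at most $k$ occurrences of $2$. *)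

theory Defs
  imports Complex_Main "HOL-Library.Poly_Mapping"
begin

text \<open>The polynomial ring over the rationals in commuting indeterminates indexed by \<open>nat\<close>:
  finitely supported functions from exponent vectors to coefficients.\<close>

type_synonym qpoly = "(nat \<Rightarrow>\<^sub>0 nat) \<Rightarrow>\<^sub>0 rat"

definition scaleQ :: "rat \<Rightarrow> qpoly \<Rightarrow> qpoly"
  where "scaleQ c p = Poly_Mapping.map ((*) c) p"

lemma lookup_scaleQ: "Poly_Mapping.lookup (scaleQ c p) m = c * Poly_Mapping.lookup p m"
  by (simp add: scaleQ_def Poly_Mapping.map.rep_eq when_def)

global_interpretation qpoly: vector_space scaleQ
  by unfold_locales
    (auto intro!: poly_mapping_eqI simp: lookup_scaleQ Poly_Mapping.lookup_add algebra_simps)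

definition var :: "nat \<Rightarrow> qpoly"
  where "var i = Poly_Mapping.single (Poly_Mapping.single i 1) 1"

definition ksubsets :: "nat \<Rightarrow> nat \<Rightarrow> nat set set"
  where "ksubsets n k = {I. I \<subseteq> {1..n} \<and> card I = k}"

definition sqfree_monom :: "nat set \<Rightarrow> qpoly"
  where "sqfree_monom I = (\<Prod>i\<in>I. var i)"

definition V :: "nat \<Rightarrow> nat \<Rightarrow> qpoly set"
  where "V n k = qpoly.span (sqfree_monom ` ksubsets n k)"

text \<open>The coefficient of \<open>sqfree_monom I\<close> in \<open>v\<close>.\<close>

definition sqfree_coeff :: "qpoly \<Rightarrow> nat set \<Rightarrow> rat"
  where "sqfree_coeff v I = Poly_Mapping.lookup v (\<Sum>i\<in>I. Poly_Mapping.single i 1)"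

definition lex_less :: "nat set \<Rightarrow> nat set \<Rightarrow> bool"
  where "lex_less I J \<longleftrightarrow> I \<noteq> J \<and> Min ((I - J) \<union> (J - I)) \<in> I"

text \<open>This is unrelated to the order that the library puts on the type \<open>qpoly\<close>.\<close>

definition positive :: "nat \<Rightarrow> nat \<Rightarrow> qpoly \<Rightarrow> bool"
  where "positive n k v \<longleftrightarrow> v \<in> V n k \<and>
    (\<exists>I\<in>ksubsets n k. sqfree_coeff v I > 0 \<and>
      (\<forall>J\<in>ksubsets n k. J \<noteq> I \<and> sqfree_coeff v J \<noteq> 0 \<longrightarrow> lex_less I J))"

definition is_kroot :: "nat \<Rightarrow> nat \<Rightarrow> qpoly \<Rightarrow> bool"
  where "is_kroot n k v \<longleftrightarrow>
    (\<exists>(i :: nat \<Rightarrow> nat) (e :: nat \<Rightarrow> rat).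
      inj_on i {1..2*k} \<and> i ` {1..2*k} \<subseteq> {1..n} \<and> e ` {1..2*k} \<subseteq> {1, -1} \<and>
      v = (\<Prod>r=1..k. scaleQ (e (2*r-1)) (var (i (2*r-1))) + scaleQ (e (2*r)) (var (i (2*r)))))"

definition pos_kroots :: "nat \<Rightarrow> nat \<Rightarrow> qpoly set"
  where "pos_kroots n k = {v. is_kroot n k v \<and> positive n k v}"

datatype kind = Symm | Antisymm

text \<open>A triple \<open>(i, j, s)\<close> encodes the factor \<open>var i + var j\<close> or \<open>var i - var j\<close>.\<close>

type_synonym root_factor = "nat \<times> nat \<times> kind"

fun factor_poly :: "root_factor \<Rightarrow> qpoly"
  where
    "factor_poly (i, j, Symm) = var i + var j"
  | "factor_poly (i, j, Antisymm) = var i - var j"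

fun factor_indices :: "root_factor \<Rightarrow> nat set"
  where "factor_indices (i, j, s) = {i, j}"

text \<open>Factors of a normal form are pairwise distinct, so a set of factors records the
  normal form up to reordering.\<close>

definition is_normal_form :: "nat \<Rightarrow> nat \<Rightarrow> qpoly \<Rightarrow> root_factor set \<Rightarrow> bool"
  where "is_normal_form n k v F \<longleftrightarrow>
    card F = k \<and>
    (\<forall>(i, j, s)\<in>F. 1 \<le> i \<and> i < j \<and> j \<le> n) \<and>
    (\<forall>f\<in>F. \<forall>g\<in>F. f \<noteq> g \<longrightarrow> factor_indices f \<inter> factor_indices g = {}) \<and>
    v = (\<Prod>f\<in>F. factor_poly f)"

text \<open>Every positive k-root has exactly one normal form, so the description is proper there.\<close>

definition normal_form :: "nat \<Rightarrow> nat \<Rightarrow> qpoly \<Rightarrow> root_factor set"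
  where "normal_form n k v = (THE F. is_normal_form n k v F)"

definition unused :: "nat \<Rightarrow> root_factor set \<Rightarrow> nat \<Rightarrow> bool"
  where "unused n F j \<longleftrightarrow> j \<in> {1..n} \<and> j \<notin> (\<Union>f\<in>F. factor_indices f)"

definition has_defect :: "nat \<Rightarrow> nat \<Rightarrow> qpoly \<Rightarrow> bool"
  where "has_defect n k v \<longleftrightarrow> (let F = normal_form n k v in
    (\<exists>i j r s a b. i < j \<and> j < r \<and> r < s \<and> (i, r, a) \<in> F \<and> (j, s, b) \<in> F) \<or>
    (\<exists>i j r s a. i < j \<and> j < r \<and> r < s \<and> (i, s, a) \<in> F \<and> (j, r, Symm) \<in> F) \<or>
    (\<exists>i j r a. i < j \<and> j < r \<and> (i, r, a) \<in> F \<and> unused n F j) \<or>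
    (\<exists>i j r. i < j \<and> j < r \<and> (i, j, Symm) \<in> F \<and> unused n F r))"

definition B :: "nat \<Rightarrow> nat \<Rightarrow> qpoly set"
  where "B n k = {v \<in> pos_kroots n k. \<not> has_defect n k v}"

definition label :: "nat \<Rightarrow> nat \<Rightarrow> qpoly \<Rightarrow> nat list"
  where "label n k v =
    map (\<lambda>j. if \<exists>i<j. (i, j, Antisymm) \<in> normal_form n k v then 2 else 1) [1..<n+1]"

definition lattice_words :: "nat \<Rightarrow> nat \<Rightarrow> nat list set"
  where "lattice_words n k = {w. length w = n \<and> set w \<subseteq> {1, 2} \<and>
    (\<forall>m\<le>n. count_list (take m w) 2 \<le> count_list (take m w) 1) \<and> count_list w 2 \<le> k}"

definition pos_lin_comb :: "qpoly \<Rightarrow> qpoly set \<Rightarrow> bool"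
  where "pos_lin_comb v S \<longleftrightarrow>
    (\<exists>T c. finite T \<and> T \<subseteq> S \<and> (\<forall>u\<in>T. c u > 0) \<and> v = (\<Sum>u\<in>T. scaleQ (c u) u))"

end

theory Submission
  imports Defs
begin

text \<open>
  Positive \<open>k\<close>-roots correspond bijectively to signed partial matchings of \<open>{1..n}\<close> with \<open>k\<close> edges:
  the matching is recovered from the points at which the product vanishes.
  Each kind of defect can be rewritten locally, for instance
  \<open>(x\<^sub>i - x\<^sub>r)(x\<^sub>j \<plusminus> x\<^sub>s) = (x\<^sub>i - x\<^sub>j)(x\<^sub>r \<plusminus> x\<^sub>s) + (x\<^sub>i \<plusminus> x\<^sub>s)(x\<^sub>j - x\<^sub>r)\<close>, into a sum of positive roots that are
  smaller in a well-founded order, so the defect-free roots span \<open>V n k\<close> with nonnegative integer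
  coefficients. In a defect-free matching the antisymmetric edges form the bracket matching of the
  label, and the symmetric edges join the unbracketed indices in consecutive pairs from the right;
  hence the label determines the matching. There are \<open>n choose k\<close> lattice words, which is the
  dimension of \<open>V n k\<close>, so the spanning set is a basis and the labelling is onto.
\<close>

section \<open>Squarefree polynomials\<close>

lemma scaleQ_mult_left: "scaleQ c p * q = scaleQ c (p * q)"
proof -
  \<comment> \<open>Scaling is multiplication by a constant polynomial.\<close>
  have "scaleQ c p = Poly_Mapping.single 0 c * p" for p
    by (rule poly_mapping_eqI) (simp add: lookup_scaleQ lookup_single lookup_mult prod_fun_def when_mult)
  then show ?thesis
    by (simp add: mult.assoc)
qed

lemma scaleQ_mult_right: "p * scaleQ c q = scaleQ c (p * q)"
  by (metis mult.commute scaleQ_mult_left)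

lemma prod_scaleQ: "(\<Prod>x\<in>A. scaleQ (c x) (p x)) = scaleQ (\<Prod>x\<in>A. c x) (\<Prod>x\<in>A. p x)"
  by (induction A rule: infinite_finite_induct)
    (simp_all add: scaleQ_mult_left scaleQ_mult_right mult.commute)

definition expo :: "nat set \<Rightarrow> nat \<Rightarrow>\<^sub>0 nat"
  where "expo I = (\<Sum>i\<in>I. Poly_Mapping.single i 1)"

lemma lookup_expo: "finite I \<Longrightarrow> Poly_Mapping.lookup (expo I) i = of_bool (i \<in> I)"
  by (auto simp: expo_def lookup_sum lookup_single when_def)

lemma expo_eq_iff: "finite I \<Longrightarrow> finite J \<Longrightarrow> expo I = expo J \<longleftrightarrow> I = J"
  by (metis lookup_expo of_bool_eq_iff set_eqI)

lemma sqfree_monom_eq_single: "sqfree_monom I = Poly_Mapping.single (expo I) 1"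
  unfolding sqfree_monom_def expo_def
  by (induction I rule: infinite_finite_induct) (simp_all add: var_def mult_single)

lemma sqfree_coeff_monom:
  "finite I \<Longrightarrow> finite J \<Longrightarrow> sqfree_coeff (sqfree_monom I) J = of_bool (I = J)"
  unfolding sqfree_coeff_def sqfree_monom_eq_single expo_def[symmetric]
  by (simp add: lookup_single when_def expo_eq_iff)

lemma sqfree_coeff_scaleQ: "sqfree_coeff (scaleQ c v) I = c * sqfree_coeff v I"
  by (simp add: sqfree_coeff_def lookup_scaleQ)

lemma sqfree_coeff_uminus: "sqfree_coeff (- v) I = - sqfree_coeff v I"
  by (simp add: sqfree_coeff_def lookup_uminus)

lemma sqfree_coeff_sum: "sqfree_coeff (\<Sum>x\<in>A. f x) I = (\<Sum>x\<in>A. sqfree_coeff (f x) I)"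
  by (simp add: sqfree_coeff_def lookup_sum)

lemma finite_ksubsets [simp]: "finite (ksubsets n k)"
  by (rule finite_subset[of _ "Pow {1..n}"]) (auto simp: ksubsets_def)

lemma ksubsets_finite: "I \<in> ksubsets n k \<Longrightarrow> finite I"
  by (auto simp: ksubsets_def intro: finite_subset)

lemma card_ksubsets: "card (ksubsets n k) = n choose k"
  using n_subsets[of "{1..n}" k] by (simp add: ksubsets_def)

lemma inj_on_sqfree_monom: "inj_on sqfree_monom (ksubsets n k)"
proof (rule inj_onI)
  fix I J assume "I \<in> ksubsets n k" "J \<in> ksubsets n k" "sqfree_monom I = sqfree_monom J"
  then show "I = J"
    using sqfree_coeff_monom[of I J] sqfree_coeff_monom[of J J] ksubsets_finite
    by (metis of_bool_eq_iff)
qed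

lemma independent_sqfree_monoms: "qpoly.independent (sqfree_monom ` ksubsets n k)"
proof (rule qpoly.independent_if_scalars_zero)
  fix f v assume sum0: "(\<Sum>x\<in>sqfree_monom ` ksubsets n k. scaleQ (f x) x) = 0"
    and "v \<in> sqfree_monom ` ksubsets n k"
  then obtain J where J: "J \<in> ksubsets n k" "v = sqfree_monom J" by auto
  have "0 = sqfree_coeff (\<Sum>x\<in>sqfree_monom ` ksubsets n k. scaleQ (f x) x) J"
    by (simp add: sum0 sqfree_coeff_def)
  also have "\<dots> = (\<Sum>I\<in>ksubsets n k. f (sqfree_monom I) * of_bool (I = J))"
    using J by (simp add: sum.reindex[OF inj_on_sqfree_monom] sqfree_coeff_sum
        sqfree_coeff_scaleQ sqfree_coeff_monom ksubsets_finite cong: sum.cong)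
  also have "\<dots> = f v"
    using J by (simp add: if_distrib cong: if_cong)
  finally show "f v = 0" by simp
qed simp

lemma dim_V: "qpoly.dim (V n k) = n choose k"
  unfolding V_def qpoly.dim_span_eq_card_independent[OF independent_sqfree_monoms]
  by (simp add: card_image inj_on_sqfree_monom card_ksubsets)

lemma lex_less_asym:
  assumes "finite I" "finite J" "lex_less I J" shows "\<not> lex_less J I"
proof -
  have "Min ((I - J) \<union> (J - I)) \<in> (I - J) \<union> (J - I)"
    using assms by (intro Min_in) (auto simp: lex_less_def)
  then show ?thesis
    using assms(3) by (auto simp: lex_less_def Un_commute)
qed

section \<open>Signed matchings\<close>

definition lft :: "root_factor \<Rightarrow> nat" where "lft f = fst f"
definition rgt :: "root_factor \<Rightarrow> nat" where "rgt f = fst (snd f)"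
definition sgnf :: "root_factor \<Rightarrow> rat" where "sgnf f = (if snd (snd f) = Symm then 1 else -1)"

lemma endpoint_simps [simp]: "lft (i, j, s) = i" "rgt (i, j, s) = j"
  "sgnf (i, j, Symm) = 1" "sgnf (i, j, Antisymm) = -1"
  by (simp_all add: lft_def rgt_def sgnf_def)

lemma factor_indices_eq: "factor_indices f = {lft f, rgt f}"
  by (cases f) auto

lemma factor_poly_eq: "factor_poly f = var (lft f) + scaleQ (sgnf f) (var (rgt f))"
  by (cases f rule: factor_poly.cases) auto

lemma sgnf_cases: "sgnf f = 1 \<or> sgnf f = -1"
  by (simp add: sgnf_def)

text \<open>The part of \<open>is_normal_form\<close> that mentions neither the number of factors
  nor the polynomial, so that parts of a normal form satisfy it too.\<close>

definition matching :: "nat \<Rightarrow> root_factor set \<Rightarrow> bool"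
  where "matching n F \<longleftrightarrow>
    (\<forall>f\<in>F. 1 \<le> lft f \<and> lft f < rgt f \<and> rgt f \<le> n) \<and>
    (\<forall>f\<in>F. \<forall>g\<in>F. f \<noteq> g \<longrightarrow> factor_indices f \<inter> factor_indices g = {})"

definition fprod :: "root_factor set \<Rightarrow> qpoly"
  where "fprod F = (\<Prod>f\<in>F. factor_poly f)"

definition all_indices :: "root_factor set \<Rightarrow> nat set"
  where "all_indices F = (\<Union>f\<in>F. factor_indices f)"

lemma is_normal_form_iff: "is_normal_form n k v F \<longleftrightarrow> card F = k \<and> matching n F \<and> v = fprod F"
  by (auto simp: is_normal_form_def matching_def fprod_def lft_def rgt_def)

lemma matchingD:
  assumes "matching n F" "f \<in> F"
  shows "1 \<le> lft f" "lft f < rgt f" "rgt f \<le> n"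
  using assms by (auto simp: matching_def)

lemma matching_subset:
  assumes "matching n F"
  shows "F \<subseteq> {1..n} \<times> {1..n} \<times> {Symm, Antisymm}"
proof
  fix f assume "f \<in> F"
  with matchingD[OF assms this] show "f \<in> {1..n} \<times> {1..n} \<times> {Symm, Antisymm}"
    by (cases f rule: factor_poly.cases) auto
qed

lemma matching_finite: "matching n F \<Longrightarrow> finite F"
  by (rule finite_subset[OF matching_subset]) auto

lemma matching_eq:
  assumes "matching n F" "f \<in> F" "g \<in> F" "x \<in> factor_indices f" "x \<in> factor_indices g"
  shows "f = g"
  using assms by (auto simp: matching_def)

lemma matching_inj:
  assumes "matching n F"
  shows "inj_on lft F" "inj_on rgt F" "f \<in> F \<Longrightarrow> g \<in> F \<Longrightarrow> lft f \<noteq> rgt g"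
proof -
  show "inj_on lft F" "inj_on rgt F"
    by (rule inj_onI, rule matching_eq[OF assms], auto simp: factor_indices_eq)+
  show "lft f \<noteq> rgt g" if "f \<in> F" "g \<in> F"
  proof
    assume "lft f = rgt g"
    then have "f = g"
      using that by (intro matching_eq[OF assms, of f g "rgt g"]) (auto simp: factor_indices_eq)
    with \<open>lft f = rgt g\<close> matchingD(2)[OF assms that(2)] show False by simp
  qed
qed

section \<open>Expansion of a product: one monomial per choice of endpoints\<close>

definition transversal :: "root_factor set \<Rightarrow> root_factor set \<Rightarrow> nat set"
  where "transversal F S = rgt ` S \<union> lft ` (F - S)"

lemma rgt_mem_transversal_iff:
  assumes "matching n F" "S \<subseteq> F" "f \<in> F"
  shows "rgt f \<in> transversal F S \<longleftrightarrow> f \<in> S"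
proof -
  have "rgt f \<notin> lft ` (F - S)"
    using matching_inj(3)[OF assms(1) _ assms(3)] by (metis DiffD1 imageE)
  then show ?thesis
    using inj_on_image_mem_iff[OF matching_inj(2)[OF assms(1)] assms(3,2)]
    by (simp add: transversal_def)
qed

text \<open>The right endpoints present in a transversal tell which factors lie in \<open>S\<close>;
  hence no two terms of the expanded product merge or cancel.\<close>

lemma inj_on_transversal: "matching n F \<Longrightarrow> inj_on (transversal F) (Pow F)"
  by (rule inj_onI) (use rgt_mem_transversal_iff in blast)

lemma disjoint_endpoints:
  assumes "matching n F" "S \<subseteq> F"
  shows "rgt ` S \<inter> lft ` (F - S) = {}"
  using rgt_mem_transversal_iff[OF assms] matching_inj(3)[OF assms(1)] assms(2)
  by (auto simp: disjoint_iff) (metis subsetD)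

lemma transversal_in_ksubsets:
  assumes "matching n F" "S \<subseteq> F"
  shows "transversal F S \<in> ksubsets n (card F)"
proof -
  have fin: "finite F" "finite S"
    using assms matching_finite finite_subset by blast+
  have "card (transversal F S) = card (rgt ` S) + card (lft ` (F - S))"
    unfolding transversal_def
    using disjoint_endpoints[OF assms] fin by (intro card_Un_disjoint) auto
  also have "card (rgt ` S) = card S"
    using matching_inj(2)[OF assms(1)] assms(2) by (meson card_image inj_on_subset)
  also have "card (lft ` (F - S)) = card (F - S)"
    using matching_inj(1)[OF assms(1)] by (meson card_image inj_on_subset Diff_subset)
  also have "card S + card (F - S) = card F"
    using assms matching_finite by (metis card_Diff_subset card_mono finite_subset le_add_diff_inverse)
  finally show ?thesis
    using matchingD[OF assms(1)] assms(2)
    by (force simp: ksubsets_def transversal_def)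
qed

lemma prod_transversal:
  assumes "matching n F" "S \<subseteq> F"
  shows "(\<Prod>i\<in>transversal F S. a i) = (\<Prod>f\<in>S. a (rgt f)) * (\<Prod>f\<in>F - S. a (lft f))"
proof -
  have fin: "finite F" "finite S"
    using assms matching_finite finite_subset by blast+
  have "(\<Prod>i\<in>transversal F S. a i) = (\<Prod>i\<in>rgt ` S. a i) * (\<Prod>i\<in>lft ` (F - S). a i)"
    unfolding transversal_def
    using disjoint_endpoints[OF assms] fin by (intro prod.union_disjoint) auto
  then show ?thesis
    using matching_inj(1,2)[OF assms(1)] assms(2)
    by (simp add: prod.reindex inj_on_subset[OF _ Diff_subset] inj_on_subset)
qed

lemma fprod_expand:
  assumes "matching n F"
  shows "fprod F = (\<Sum>S\<in>Pow F. scaleQ (\<Prod>f\<in>S. sgnf f) (sqfree_monom (transversal F S)))"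
proof -
  \<comment> \<open>The summands are swapped so that in \<open>prod_add\<close> the set
    \<open>S\<close> collects the factors contributing their right endpoint, the only place where
    signs enter.\<close>
  have "fprod F = (\<Prod>f\<in>F. scaleQ (sgnf f) (var (rgt f)) + var (lft f))"
    by (simp add: fprod_def factor_poly_eq add.commute)
  also have "\<dots> = (\<Sum>S\<in>Pow F. (\<Prod>f\<in>S. scaleQ (sgnf f) (var (rgt f))) * (\<Prod>f\<in>F - S. var (lft f)))"
    by (rule prod_add[OF matching_finite[OF assms]])
  also have "\<dots> = (\<Sum>S\<in>Pow F. scaleQ (\<Prod>f\<in>S. sgnf f) (sqfree_monom (transversal F S)))"
    by (intro sum.cong refl)
      (simp add: sqfree_monom_def prod_scaleQ scaleQ_mult_left prod_transversal[OF assms])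
  finally show ?thesis .
qed

lemma coeff_fprod:
  assumes "matching n F" "finite J"
  shows "sqfree_coeff (fprod F) J =
    (\<Sum>S\<in>Pow F. (\<Prod>f\<in>S. sgnf f) * of_bool (transversal F S = J))"
  unfolding fprod_expand[OF assms(1)] sqfree_coeff_sum sqfree_coeff_scaleQ
proof (intro sum.cong refl)
  fix S assume "S \<in> Pow F"
  then have "finite (transversal F S)"
    using transversal_in_ksubsets[OF assms(1)] ksubsets_finite by blast
  then show "(\<Prod>f\<in>S. sgnf f) * sqfree_coeff (sqfree_monom (transversal F S)) J =
      (\<Prod>f\<in>S. sgnf f) * of_bool (transversal F S = J)"
    by (simp add: sqfree_coeff_monom assms(2))
qed

lemma coeff_fprod_transversal:
  assumes "matching n F" "S \<subseteq> F"
  shows "sqfree_coeff (fprod F) (transversal F S) = (\<Prod>f\<in>S. sgnf f)"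
proof -
  have "finite (transversal F S)"
    using transversal_in_ksubsets[OF assms] ksubsets_finite by blast
  then have "sqfree_coeff (fprod F) (transversal F S) =
      (\<Sum>S'\<in>Pow F. (\<Prod>f\<in>S'. sgnf f) * of_bool (transversal F S' = transversal F S))"
    by (rule coeff_fprod[OF assms(1)])
  also have "\<dots> = (\<Sum>S'\<in>Pow F. if S' = S then \<Prod>f\<in>S'. sgnf f else 0)"
    using inj_onD[OF inj_on_transversal[OF assms(1)]] assms(2)
    by (intro sum.cong refl) auto
  also have "\<dots> = (\<Prod>f\<in>S. sgnf f)"
    using assms(2) matching_finite[OF assms(1)] by (simp add: sum.delta)
  finally show ?thesis .
qed

lemma coeff_fprod_nonzeroE:
  assumes "matching n F" "finite J" "sqfree_coeff (fprod F) J \<noteq> 0"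
  obtains S where "S \<subseteq> F" "J = transversal F S"
proof -
  obtain S where "S \<in> Pow F" "(\<Prod>f\<in>S. sgnf f) * of_bool (transversal F S = J) \<noteq> 0"
    using assms(3) unfolding coeff_fprod[OF assms(1,2)]
    by (rule sum.not_neutral_contains_not_neutral)
  then show thesis
    using that[of S] by (auto split: if_splits)
qed

text \<open>Each monomial arises from at most one choice, so its coefficient is a single product of
  signs. This later excludes proper multiples among the roots.\<close>

lemma coeff_fprod_cases:
  assumes "matching n F" "finite J"
  shows "sqfree_coeff (fprod F) J \<in> {0, 1, -1}"
proof (cases "sqfree_coeff (fprod F) J = 0")
  case False
  then obtain S where S: "S \<subseteq> F" "J = transversal F S"
    using assms coeff_fprod_nonzeroE by blast
  have "(\<Prod>f\<in>S. sgnf f) \<in> {1, -1}"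
  proof (induction S rule: infinite_finite_induct)
    case (insert f S)
    then show ?case using sgnf_cases[of f] by auto
  qed auto
  then show ?thesis
    using coeff_fprod_transversal assms S by auto
qed simp

section \<open>Leading monomials and positivity\<close>

lemma coeff_fprod_leading: "matching n F \<Longrightarrow> sqfree_coeff (fprod F) (lft ` F) = 1"
  using coeff_fprod_transversal[of n F "{}"] by (simp add: transversal_def)

lemma lft_image_in_ksubsets: "matching n F \<Longrightarrow> lft ` F \<in> ksubsets n (card F)"
  using transversal_in_ksubsets[of n F "{}"] by (simp add: transversal_def)

lemma fprod_nonzero: "matching n F \<Longrightarrow> fprod F \<noteq> 0"
  using coeff_fprod_leading by (force simp: sqfree_coeff_def)

lemma fprod_in_V:
  assumes "matching n F" shows "fprod F \<in> V n (card F)"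
proof -
  have "scaleQ c (sqfree_monom (transversal F S)) \<in> V n (card F)" if "S \<in> Pow F" for c S
    using transversal_in_ksubsets[OF assms] that
    unfolding V_def by (intro qpoly.span_scale qpoly.span_base) simp
  then show ?thesis
    unfolding fprod_expand[OF assms] V_def by (rule qpoly.span_sum)
qed

text \<open>The two index sets differ exactly in the endpoints of the factors in \<open>S\<close>.
  The least of these is a left endpoint, as each right endpoint exceeds its own left one.\<close>

lemma lex_less_lft_image:
  assumes "matching n F" "S \<subseteq> F" "S \<noteq> {}"
  shows "lex_less (lft ` F) (transversal F S)"
proof -
  have "lft ` (F - S) = lft ` F - lft ` S"
    using matching_inj(1)[OF assms(1)] assms(2) by (intro inj_on_image_set_diff) auto
  moreover have "lft ` S \<subseteq> lft ` F" using assms(2) by blast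
  moreover have "rgt ` S \<inter> lft ` F = {}"
  proof (rule equals0I)
    fix x assume "x \<in> rgt ` S \<inter> lft ` F"
    then obtain f g where "f \<in> S" "g \<in> F" "lft g = rgt f" by (metis IntE imageE)
    then show False using matching_inj(3)[OF assms(1), of g f] assms(2) by blast
  qed
  ultimately have 1: "lft ` F - transversal F S = lft ` S" and 2: "transversal F S - lft ` F = rgt ` S"
    unfolding transversal_def by blast+
  have fin: "finite S"
    using assms matching_finite finite_subset by blast
  have "Min (lft ` S \<union> rgt ` S) \<in> lft ` S \<union> rgt ` S"
    using fin assms(3) by (intro Min_in) auto
  moreover have "Min (lft ` S \<union> rgt ` S) \<noteq> rgt f" if "f \<in> S" for f
  proof -
    have "Min (lft ` S \<union> rgt ` S) \<le> lft f" using fin that by (intro Min_le) auto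
    also have "\<dots> < rgt f" using matchingD assms that by blast
    finally show ?thesis by simp
  qed
  ultimately have "Min (lft ` S \<union> rgt ` S) \<in> lft ` S" by blast
  then show ?thesis
    using 1 2 by (auto simp: lex_less_def)
qed

lemma positive_fprod:
  assumes "matching n F"
  shows "positive n (card F) (fprod F)"
  unfolding positive_def
proof (intro conjI bexI[of _ "lft ` F"] ballI impI)
  fix J assume J: "J \<in> ksubsets n (card F)" "J \<noteq> lft ` F \<and> sqfree_coeff (fprod F) J \<noteq> 0"
  then obtain S where S: "S \<subseteq> F" "J = transversal F S"
    using coeff_fprod_nonzeroE[OF assms] ksubsets_finite by metis
  moreover have "S \<noteq> {}"
    using J S by (auto simp: transversal_def)
  ultimately show "lex_less (lft ` F) J"
    using lex_less_lft_image[OF assms] by simp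
qed (use assms in \<open>auto simp: fprod_in_V coeff_fprod_leading lft_image_in_ksubsets\<close>)

lemma not_positive_neg_fprod:
  assumes "matching n F"
  shows "\<not> positive n (card F) (- fprod F)"
proof
  assume "positive n (card F) (- fprod F)"
  then obtain I where I: "I \<in> ksubsets n (card F)" "sqfree_coeff (fprod F) I < 0"
    "\<And>J. J \<in> ksubsets n (card F) \<Longrightarrow> J \<noteq> I \<Longrightarrow> sqfree_coeff (fprod F) J \<noteq> 0 \<Longrightarrow> lex_less I J"
    by (auto simp: positive_def sqfree_coeff_uminus)
  \<comment> \<open>The coefficient at \<open>I\<close> is negative, the one at the left endpoints
    is 1. So the two sets differ, and each would have to precede the other.\<close>
  then have "I \<noteq> lft ` F"
    using coeff_fprod_leading[OF assms] by auto
  then have "lex_less I (lft ` F)"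
    using I coeff_fprod_leading[OF assms] lft_image_in_ksubsets[OF assms] by simp
  moreover obtain S where "S \<subseteq> F" "I = transversal F S"
    using coeff_fprod_nonzeroE[OF assms ksubsets_finite[OF I(1)]] I(2) by auto
  ultimately show False
    using lex_less_lft_image[OF assms, of S] lex_less_asym[of I "lft ` F"] \<open>I \<noteq> lft ` F\<close>
      ksubsets_finite[OF I(1)] matching_finite[OF assms] by (auto simp: transversal_def)
qed

section \<open>Recovering a matching from the zeros of its product\<close>

definition sqfree_eval :: "nat \<Rightarrow> nat \<Rightarrow> (nat \<Rightarrow> rat) \<Rightarrow> qpoly \<Rightarrow> rat"
  where "sqfree_eval n k a v = (\<Sum>I\<in>ksubsets n k. sqfree_coeff v I * (\<Prod>i\<in>I. a i))"

text \<open>\<open>sqfree_eval\<close> is evaluation at \<open>a\<close> written through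
  coefficients: it depends on the polynomial alone, while the product formula displays its zeros in
  terms of \<open>F\<close>.\<close>

lemma sqfree_eval_fprod:
  assumes "matching n F"
  shows "sqfree_eval n (card F) a (fprod F) = (\<Prod>f\<in>F. a (lft f) + sgnf f * a (rgt f))"
proof -
  have "sqfree_eval n (card F) a (fprod F) =
      (\<Sum>I\<in>ksubsets n (card F). \<Sum>S\<in>Pow F. (\<Prod>f\<in>S. sgnf f) * of_bool (transversal F S = I) * (\<Prod>i\<in>I. a i))"
    unfolding sqfree_eval_def
    by (intro sum.cong refl) (simp add: coeff_fprod[OF assms] ksubsets_finite sum_distrib_right)
  also have "\<dots> = (\<Sum>S\<in>Pow F. \<Sum>I\<in>ksubsets n (card F). (\<Prod>f\<in>S. sgnf f) * of_bool (transversal F S = I) * (\<Prod>i\<in>I. a i))"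
    by (rule sum.swap)
  also have "\<dots> = (\<Sum>S\<in>Pow F. (\<Prod>f\<in>S. sgnf f) * (\<Prod>i\<in>transversal F S. a i))"
  proof (intro sum.cong refl)
    fix S assume "S \<in> Pow F"
    then have "transversal F S \<in> ksubsets n (card F)"
      using transversal_in_ksubsets[OF assms] by simp
    then show "(\<Sum>I\<in>ksubsets n (card F). (\<Prod>f\<in>S. sgnf f) * of_bool (transversal F S = I) * (\<Prod>i\<in>I. a i)) =
        (\<Prod>f\<in>S. sgnf f) * (\<Prod>i\<in>transversal F S. a i)"
      by (subst sum.mono_neutral_cong_right[of _ "{transversal F S}"]) auto
  qed
  also have "\<dots> = (\<Sum>S\<in>Pow F. (\<Prod>f\<in>S. sgnf f * a (rgt f)) * (\<Prod>f\<in>F - S. a (lft f)))"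
    by (intro sum.cong refl) (simp add: prod_transversal[OF assms] prod.distrib)
  also have "\<dots> = (\<Prod>f\<in>F. sgnf f * a (rgt f) + a (lft f))"
    by (rule prod_add[symmetric, OF matching_finite[OF assms]])
  finally show ?thesis by (simp add: add.commute)
qed

text \<open>Evaluate at a point at which \<open>factor_poly f\<close> vanishes and no other factor can vanish.\<close>

lemma mem_matching_iff_eval:
  assumes "matching n F" "1 \<le> lft f" "lft f < rgt f"
  shows "f \<in> F \<longleftrightarrow>
    sqfree_eval n (card F) (\<lambda>m. if m = rgt f then - sgnf f * of_nat (lft f) else of_nat m) (fprod F) = 0"
    (is "_ \<longleftrightarrow> sqfree_eval n _ ?a _ = 0")
proof -
  \<comment> \<open>A factor avoiding \<open>rgt f\<close> becomes a sum or difference of two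
    distinct positive integers. One that meets \<open>rgt f\<close> vanishes only if its other
    endpoint is \<open>lft f\<close> and its sign is that of \<open>f\<close>.\<close>
  have "?a (lft g) + sgnf g * ?a (rgt g) = 0 \<longleftrightarrow> g = f" if "g \<in> F" for g
  proof
    assume *: "?a (lft g) + sgnf g * ?a (rgt g) = 0"
    have "1 \<le> lft g" "lft g < rgt g" using matchingD[OF assms(1) that] by auto
    with assms(2,3) * show "g = f"
      by (cases f; cases g; cases "snd (snd f)"; cases "snd (snd g)") (auto split: if_splits)
  next
    assume "g = f"
    then show "?a (lft g) + sgnf g * ?a (rgt g) = 0"
      using assms(2,3) sgnf_cases[of f] by auto
  qed
  then show ?thesis
    using matching_finite[OF assms(1)] by (auto simp: sqfree_eval_fprod[OF assms(1)])
qed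

text \<open>By \<open>mem_matching_iff_eval\<close>, the polynomial and the number of factors decide
  which factors occur.\<close>

lemma fprod_inject:
  assumes "matching n F" "matching n G" "card F = card G" "fprod F = fprod G"
  shows "F = G"
  using assms mem_matching_iff_eval[OF assms(1)] mem_matching_iff_eval[OF assms(2)]
    matchingD[OF assms(1)] matchingD[OF assms(2)] by (metis subsetI subset_antisym)

section \<open>Positive roots as products of matchings\<close>

lemma signed_product_eq_fprod:
  assumes "finite R" and range: "\<And>r. r \<in> R \<Longrightarrow> a r \<in> {1..n} \<and> b r \<in> {1..n} \<and> a r \<noteq> b r"
    and disj: "\<And>r r'. r \<in> R \<Longrightarrow> r' \<in> R \<Longrightarrow> r \<noteq> r' \<Longrightarrow> {a r, b r} \<inter> {a r', b r'} = {}"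
    and sign: "\<And>r. r \<in> R \<Longrightarrow> d r \<in> {1, -1} \<and> e r \<in> {1, -1}"
  obtains F where "matching n F" "card F = card R"
    "(\<Prod>r\<in>R. scaleQ (d r) (var (a r)) + scaleQ (e r) (var (b r))) \<in> {fprod F, - fprod F}"
proof -
  define g where "g = (\<lambda>r. (min (a r) (b r), max (a r) (b r), if d r = e r then Symm else Antisymm))"
  \<comment> \<open>\<open>c r\<close> is the sign of the variable with the smaller index; once it
    is pulled out, the factor is symmetric iff its two signs agree.\<close>
  define c where "c = (\<lambda>r. if a r < b r then d r else e r)"
  have ind: "factor_indices (g r) = {a r, b r}" for r
    by (auto simp: g_def)
  have inj: "inj_on g R"
  proof (rule inj_onI, rule ccontr)
    fix r r' assume "r \<in> R" "r' \<in> R" "g r = g r'" "r \<noteq> r'"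
    then show False using disj[of r r'] ind[of r] ind[of r'] by auto
  qed
  have 1: "matching n (g ` R)"
    unfolding matching_def
  proof (intro conjI ballI impI)
    fix f assume "f \<in> g ` R"
    then obtain r where "r \<in> R" "f = g r" by blast
    then show "1 \<le> lft f" "lft f < rgt f" "rgt f \<le> n"
      using range[of r] by (auto simp: g_def)
  next
    fix f f' assume "f \<in> g ` R" "f' \<in> g ` R" "f \<noteq> f'"
    then obtain r r' where "r \<in> R" "f = g r" "r' \<in> R" "f' = g r'" "r \<noteq> r'" by blast
    then show "factor_indices f \<inter> factor_indices f' = {}"
      using disj[of r r'] by (simp add: ind)
  qed
  have factor: "scaleQ (d r) (var (a r)) + scaleQ (e r) (var (b r)) = scaleQ (c r) (factor_poly (g r))"
    if "r \<in> R" for r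
    using range[OF that] sign[OF that]
    by (auto simp: g_def c_def min_def max_def qpoly.scale_right_distrib qpoly.scale_right_diff_distrib)
  have "(\<Prod>r\<in>R. scaleQ (d r) (var (a r)) + scaleQ (e r) (var (b r))) = scaleQ (\<Prod>r\<in>R. c r) (fprod (g ` R))"
    by (simp add: factor prod_scaleQ fprod_def prod.reindex[OF inj] cong: prod.cong)
  moreover have "(\<Prod>r\<in>R. c r) \<in> {1, -1}"
    using assms(1) sign
  proof (induction R rule: finite_induct)
    case (insert r R)
    then have "c r \<in> {1, -1}" "(\<Prod>r\<in>R. c r) \<in> {1, -1}"
      by (auto simp: c_def)
    with insert(1,2) show ?case by auto
  qed simp
  ultimately show thesis
    using that[OF 1 card_image[OF inj]] by auto
qed

lemma is_kroot_fprod: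
  assumes "matching n F"
  shows "is_kroot n (card F) (fprod F)"
proof -
  obtain h where h: "bij_betw h {1..card F} F"
    using ex_bij_betw_nat_finite_1[OF matching_finite[OF assms]] by blast
  \<comment> \<open>Positions \<open>2*r-1\<close> and \<open>2*r\<close> both give
    \<open>(m + 1) div 2 = r\<close>: the odd one holds the left endpoint of the \<open>r\<close>-th
    factor, the even one the right endpoint.\<close>
  define i where "i = (\<lambda>m::nat. (if odd m then lft else rgt) (h ((m + 1) div 2)))"
  define e where "e = (\<lambda>m::nat. if odd m then 1 else sgnf (h ((m + 1) div 2)))"
  have hF: "h ((m + 1) div 2) \<in> F" if "m \<in> {1..2 * card F}" for m
    using that by (intro bij_betwE[OF h, rule_format]) auto
  have "inj_on i {1..2 * card F}"
  proof (rule inj_onI)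
    fix m m' assume m: "m \<in> {1..2 * card F}" "m' \<in> {1..2 * card F}" "i m = i m'"
    let ?f = "h ((m + 1) div 2)" and ?g = "h ((m' + 1) div 2)"
    have fg: "?f = ?g"
      using m(3) by (intro matching_eq[OF assms hF[OF m(1)] hF[OF m(2)], of "i m"])
        (auto simp: i_def factor_indices_eq split: if_splits)
    then have "(m + 1) div 2 = (m' + 1) div 2"
      using m by (intro inj_onD[OF bij_betw_imp_inj_on[OF h] fg]) auto
    moreover have "odd m \<longleftrightarrow> odd m'"
      using m(3) fg matchingD(2)[OF assms hF[OF m(1)]] by (auto simp: i_def split: if_splits)
    ultimately show "m = m'" by presburger
  qed
  moreover have "i m \<in> {1..n}" "e m \<in> {1, -1}" if "m \<in> {1..2 * card F}" for m
    using matchingD[OF assms hF[OF that]] sgnf_cases by (auto simp: i_def e_def)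
  moreover have "fprod F = (\<Prod>r=1..card F. scaleQ (e (2*r-1)) (var (i (2*r-1))) + scaleQ (e (2*r)) (var (i (2*r))))"
  proof -
    have "fprod F = (\<Prod>r=1..card F. factor_poly (h r))"
      unfolding fprod_def by (rule prod.reindex_bij_betw[OF h, symmetric])
    also have "\<dots> = (\<Prod>r=1..card F. scaleQ (e (2*r-1)) (var (i (2*r-1))) + scaleQ (e (2*r)) (var (i (2*r))))"
      by (intro prod.cong refl) (auto simp: factor_poly_eq i_def e_def)
    finally show ?thesis .
  qed
  ultimately show ?thesis
    unfolding is_kroot_def by (intro exI[of _ i] exI[of _ e]) (simp add: image_subset_iff)
qed

lemma is_kroot_imp_fprod:
  assumes "is_kroot n k v"
  obtains F where "matching n F" "card F = k" "v \<in> {fprod F, - fprod F}"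
proof -
  obtain i e where ie: "inj_on i {1..2*k}" "i ` {1..2*k} \<subseteq> {1..n}" "e ` {1..2*k} \<subseteq> {1, -1::rat}"
    "v = (\<Prod>r=1..k. scaleQ (e (2*r-1)) (var (i (2*r-1))) + scaleQ (e (2*r)) (var (i (2*r))))"
    using assms unfolding is_kroot_def by blast
  have eq: "i m = i m' \<longleftrightarrow> m = m'" if "m \<in> {1..2*k}" "m' \<in> {1..2*k}" for m m'
    using ie(1) that by (auto dest: inj_onD)
  show thesis
  proof (rule signed_product_eq_fprod[of "{1..k}" "\<lambda>r. i (2*r-1)" n "\<lambda>r. i (2*r)" "\<lambda>r. e (2*r-1)" "\<lambda>r. e (2*r)"])
    fix r assume "r \<in> {1..k}"
    then have "2*r-1 \<in> {1..2*k}" "2*r \<in> {1..2*k}" "2*r-1 \<noteq> 2*r" by auto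
    then show "i (2*r-1) \<in> {1..n} \<and> i (2*r) \<in> {1..n} \<and> i (2*r-1) \<noteq> i (2*r)"
      "e (2*r-1) \<in> {1, -1} \<and> e (2*r) \<in> {1, -1}"
      using ie(2,3) eq by blast+
  next
    fix r r' assume r: "r \<in> {1..k}" "r' \<in> {1..k}" "r \<noteq> r'"
    then have mem: "2*r-1 \<in> {1..2*k}" "2*r \<in> {1..2*k}" "2*r'-1 \<in> {1..2*k}" "2*r' \<in> {1..2*k}"
      by auto
    \<comment> \<open>Subtraction is truncated: \<open>1 \<le> r\<close> makes \<open>2*r-1\<close>
      odd, hence different from \<open>2*r'\<close>.\<close>
    have "1 \<le> r" "1 \<le> r'" using r by auto
    then have "2*r-1 \<noteq> 2*r'-1" "2*r-1 \<noteq> 2*r'" "2*r \<noteq> 2*r'-1" "2*r \<noteq> 2*r'"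
      using r(3) by presburger+
    with mem show "{i (2*r-1), i (2*r)} \<inter> {i (2*r'-1), i (2*r')} = {}"
      using eq by simp
  next
    fix F assume "matching n F" "card F = card {1..k}"
      "(\<Prod>r=1..k. scaleQ (e (2*r-1)) (var (i (2*r-1))) + scaleQ (e (2*r)) (var (i (2*r)))) \<in> {fprod F, - fprod F}"
    then show thesis using that[of F] ie(4) by simp
  qed simp
qed

text \<open>Translates \<open>is_kroot\<close> and \<open>positive\<close> into combinatorics; the
  sign ambiguity of a root is settled by \<open>not_positive_neg_fprod\<close>.\<close>

lemma pos_kroots_eq: "pos_kroots n k = fprod ` {F. matching n F \<and> card F = k}"
proof (intro set_eqI iffI)
  fix v assume "v \<in> pos_kroots n k"
  then have v: "is_kroot n k v" "positive n k v" by (auto simp: pos_kroots_def)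
  obtain F where F: "matching n F" "card F = k" "v \<in> {fprod F, - fprod F}"
    by (rule is_kroot_imp_fprod[OF v(1)])
  then show "v \<in> fprod ` {F. matching n F \<and> card F = k}"
    using v(2) not_positive_neg_fprod[OF F(1)] by auto
qed (auto simp: pos_kroots_def is_kroot_fprod positive_fprod)

lemma normal_form_fprod:
  assumes "matching n F"
  shows "normal_form n (card F) (fprod F) = F"
  unfolding normal_form_def is_normal_form_iff
proof (rule the_equality)
  show "G = F" if "card G = card F \<and> matching n G \<and> fprod F = fprod G" for G
    using fprod_inject[OF assms, of G] that by simp
qed (simp add: assms)

text \<open>\<open>has_defect\<close> as a condition on the matching, free of the definite
  description in \<open>normal_form\<close>.\<close>

definition defect :: "nat \<Rightarrow> root_factor set \<Rightarrow> bool"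
  where "defect n F \<longleftrightarrow>
    (\<exists>i j r s a b. i < j \<and> j < r \<and> r < s \<and> (i, r, a) \<in> F \<and> (j, s, b) \<in> F) \<or>
    (\<exists>i j r s a. i < j \<and> j < r \<and> r < s \<and> (i, s, a) \<in> F \<and> (j, r, Symm) \<in> F) \<or>
    (\<exists>i j r a. i < j \<and> j < r \<and> (i, r, a) \<in> F \<and> unused n F j) \<or>
    (\<exists>i j r. i < j \<and> j < r \<and> (i, j, Symm) \<in> F \<and> unused n F r)"

lemma defect_crossing:
  "(i, r, a) \<in> F \<Longrightarrow> (j, s, b) \<in> F \<Longrightarrow> i < j \<Longrightarrow> j < r \<Longrightarrow> r < s \<Longrightarrow> defect n F"
  unfolding defect_def by (rule disjI1, intro exI conjI)

lemma defect_nested: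
  "(i, s, a) \<in> F \<Longrightarrow> (j, r, Symm) \<in> F \<Longrightarrow> i < j \<Longrightarrow> j < r \<Longrightarrow> r < s \<Longrightarrow> defect n F"
  unfolding defect_def by (rule disjI2, rule disjI1, intro exI conjI)

lemma defect_inside:
  "(i, r, a) \<in> F \<Longrightarrow> unused n F j \<Longrightarrow> i < j \<Longrightarrow> j < r \<Longrightarrow> defect n F"
  unfolding defect_def by (rule disjI2, rule disjI2, rule disjI1, intro exI conjI)

lemma defect_right:
  "(i, j, Symm) \<in> F \<Longrightarrow> unused n F r \<Longrightarrow> i < j \<Longrightarrow> j < r \<Longrightarrow> defect n F"
  unfolding defect_def by (rule disjI2, rule disjI2, rule disjI2, intro exI conjI)

lemma B_eq: "B n k = fprod ` {F. matching n F \<and> card F = k \<and> \<not> defect n F}"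
proof -
  have "has_defect n (card F) (fprod F) = defect n F" if "matching n F" for F
    by (simp only: has_defect_def normal_form_fprod[OF that] Let_def defect_def)
  then show ?thesis by (auto simp: B_def pos_kroots_eq)
qed

lemma finite_matchings: "finite {F. matching n F}"
  by (rule finite_subset[of _ "Pow ({1..n} \<times> {1..n} \<times> {Symm, Antisymm})"])
    (use matching_subset in auto)

lemma finite_B: "finite (B n k)"
  unfolding B_eq by (intro finite_imageI finite_subset[OF _ finite_matchings[of n]]) auto

text \<open>Writing \<open>2 x\<^sub>i = (x\<^sub>i + x\<^sub>j) + (x\<^sub>i - x\<^sub>j)\<close> with a private partner \<open>j\<close> for each \<open>i \<in> I\<close>
  expresses \<open>2\<^sup>k x\<^sub>I\<close> as a sum of \<open>k\<close>-roots.\<close>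

lemma sqfree_monom_in_span_pos_kroots:
  assumes "2 * k \<le> n" "I \<in> ksubsets n k"
  shows "sqfree_monom I \<in> qpoly.span (pos_kroots n k)"
proof -
  have I: "I \<subseteq> {1..n}" "card I = k" "finite I"
    using assms(2) ksubsets_finite[OF assms(2)] by (auto simp: ksubsets_def)
  \<comment> \<open>\<open>2 * k \<le> n\<close> leaves enough indices outside \<open>I\<close> for
    distinct partners.\<close>
  have "k \<le> card ({1..n} - I)"
    using I assms(1) by (simp add: card_Diff_subset)
  then obtain J where J: "J \<subseteq> {1..n} - I" "card J = k" "finite J"
    by (rule obtain_subset_with_card_n)
  then obtain h where h: "bij_betw h I J"
    using finite_same_card_bij[OF I(3) J(3)] I(2) J(2) by auto
  have hJ: "h i \<in> J" if "i \<in> I" for i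
    using h that by (auto dest: bij_betwE)
  have signs: "(\<Prod>i\<in>S. var i + var (h i)) * (\<Prod>i\<in>I - S. var i - var (h i)) \<in> qpoly.span (pos_kroots n k)"
    if "S \<in> Pow I" for S
  proof (rule signed_product_eq_fprod[of I "\<lambda>i. i" n h "\<lambda>i. 1" "\<lambda>i. if i \<in> S then 1 else -1"])
    fix r r' assume "r \<in> I" "r' \<in> I" "r \<noteq> r'"
    moreover from this have "h r \<noteq> h r'"
      using inj_onD[OF bij_betw_imp_inj_on[OF h], of r r'] by blast
    ultimately show "{r, h r} \<inter> {r', h r'} = {}"
      using hJ[of r] hJ[of r'] J(1) by auto
  next
    fix r assume "r \<in> I"
    then have "r \<in> {1..n}" "h r \<in> {1..n} - I" using hJ[of r] I J(1) by blast+
    then show "r \<in> {1..n} \<and> h r \<in> {1..n} \<and> r \<noteq> h r" using \<open>r \<in> I\<close> by auto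
  next
    fix F assume F: "matching n F" "card F = card I"
      and prod: "(\<Prod>i\<in>I. scaleQ 1 (var i) + scaleQ (if i \<in> S then 1 else -1) (var (h i))) \<in> {fprod F, - fprod F}"
    have "(\<Prod>i\<in>I. scaleQ 1 (var i) + scaleQ (if i \<in> S then 1 else -1) (var (h i))) =
        (\<Prod>i\<in>S. var i + var (h i)) * (\<Prod>i\<in>I - S. var i - var (h i))"
    proof -
      have "(\<Prod>i\<in>I. scaleQ 1 (var i) + scaleQ (if i \<in> S then 1 else -1) (var (h i))) =
          (\<Prod>i\<in>I. if i \<in> S then var i + var (h i) else var i - var (h i))"
        by (intro prod.cong refl) simp
      also have "\<dots> = (\<Prod>i\<in>I \<inter> S. var i + var (h i)) * (\<Prod>i\<in>I - S. var i - var (h i))"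
        using prod.If_cases[OF I(3), of "\<lambda>i. i \<in> S"] by (simp add: Diff_eq)
      also have "I \<inter> S = S" using that by blast
      finally show ?thesis .
    qed
    moreover have "fprod F \<in> qpoly.span (pos_kroots n k)"
      using F I(2) by (intro qpoly.span_base) (auto simp: pos_kroots_eq)
    ultimately show ?thesis
      using prod by (auto intro: qpoly.span_neg)
  qed (use I in auto)
  have "scaleQ (2 ^ k) (sqfree_monom I) = (\<Prod>i\<in>I. scaleQ 2 (var i))"
    by (simp add: prod_scaleQ I sqfree_monom_def)
  also have "\<dots> = (\<Prod>i\<in>I. (var i + var (h i)) + (var i - var (h i)))"
    using qpoly.scale_left_distrib[of 1 1] by (intro prod.cong refl) simp
  also have "\<dots> = (\<Sum>S\<in>Pow I. (\<Prod>i\<in>S. var i + var (h i)) * (\<Prod>i\<in>I - S. var i - var (h i)))"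
    by (rule prod_add[OF I(3)])
  finally have "scaleQ (2 ^ k) (sqfree_monom I) \<in> qpoly.span (pos_kroots n k)"
    using signs by (auto intro: qpoly.span_sum)
  then have "scaleQ (1 / 2 ^ k) (scaleQ (2 ^ k) (sqfree_monom I)) \<in> qpoly.span (pos_kroots n k)"
    by (rule qpoly.span_scale)
  then show ?thesis by simp
qed

section \<open>Removing defects\<close>

text \<open>The first sum falls when a left endpoint moves right; the second when left endpoints
  stay but a crossing becomes a nesting or an edge shrinks; the third when only kinds change. Its
  weight \<open>lft f\<close> lets a symmetric inner edge be traded for a symmetric outer
  one.\<close>

definition root_order :: "nat \<Rightarrow> (root_factor set \<times> root_factor set) set"
  where "root_order n = measures
    [\<lambda>F. \<Sum>f\<in>F. n - lft f, \<lambda>F. \<Sum>f\<in>F. lft f * rgt f,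
     \<lambda>F. \<Sum>f\<in>F. if snd (snd f) = Symm then lft f else 0]"

lemma wf_root_order: "wf (root_order n)"
  by (simp add: root_order_def)

lemma root_order_irrefl: "(F, F) \<notin> root_order n"
  by (simp add: root_order_def)

text \<open>Each measure is a sum over factors, so a common disjoint part adds the same amount on
  both sides.\<close>

lemma root_order_Un:
  assumes "(A', A) \<in> root_order n" "finite X" "finite A" "finite A'" "X \<inter> A = {}" "X \<inter> A' = {}"
  shows "(X \<union> A', X \<union> A) \<in> root_order n"
  using assms by (simp add: root_order_def sum.union_disjoint)

lemma matching_replace:
  assumes F: "matching n F" "A \<subseteq> F" and A': "matching n A'" "card A' = card A"
    and ind: "all_indices A' \<subseteq> all_indices A \<union> {j. unused n F j}"
  shows "(F - A) \<inter> A' = {}" "matching n ((F - A) \<union> A')" "card ((F - A) \<union> A') = card F"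
proof -
  have disj: "factor_indices f \<inter> factor_indices g = {}" if "f \<in> F - A" "g \<in> A'" for f g
  proof (rule equals0I)
    fix x assume x: "x \<in> factor_indices f \<inter> factor_indices g"
    then have "x \<in> all_indices A'" using that by (auto simp: all_indices_def)
    then consider "x \<in> all_indices A" | "unused n F x" using ind by blast
    then show False
    proof cases
      case 1
      then obtain a where "a \<in> A" "x \<in> factor_indices a" by (auto simp: all_indices_def)
      then have "a = f"
        using matching_eq[OF F(1), of a f x] that x F(2) by blast
      with that \<open>a \<in> A\<close> show False by blast
    next
      case 2
      then show False using x that by (auto simp: unused_def)
    qed
  qed
  show 1: "(F - A) \<inter> A' = {}"
    using disj by (force simp: factor_indices_eq)
  show "matching n ((F - A) \<union> A')"
    unfolding matching_def
  proof (intro conjI ballI impI)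
    fix f assume "f \<in> F - A \<union> A'"
    then show "1 \<le> lft f" "lft f < rgt f" "rgt f \<le> n"
      using matchingD[OF F(1)] matchingD[OF A'(1)] by blast+
  next
    fix f g assume "f \<in> F - A \<union> A'" "g \<in> F - A \<union> A'" "f \<noteq> g"
    then show "factor_indices f \<inter> factor_indices g = {}"
      using disj[of f g] disj[of g f] F(1) A'(1) unfolding matching_def by blast
  qed
  have "finite F" using F matching_finite by blast
  moreover have "finite A" using F(2) \<open>finite F\<close> by (rule finite_subset)
  ultimately show "card ((F - A) \<union> A') = card F"
    using F(2) 1 A' matching_finite[OF A'(1)] card_mono[of F A]
    by (simp add: card_Un_disjoint card_Diff_subset)
qed

text \<open>An identity for a few factors is multiplied by the product of the others.\<close>

lemma expand_locally:
  assumes F: "matching n F" "A \<subseteq> F" and "finite As"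
    and As: "\<And>A'. A' \<in> As \<Longrightarrow> matching n A' \<and> card A' = card A \<and>
      all_indices A' \<subseteq> all_indices A \<union> {j. unused n F j} \<and> (A', A) \<in> root_order n"
    and sum: "fprod A = (\<Sum>A'\<in>As. fprod A')"
  obtains Fs where "finite Fs" "\<And>G. G \<in> Fs \<Longrightarrow> matching n G \<and> card G = card F \<and> (G, F) \<in> root_order n"
    "fprod F = (\<Sum>G\<in>Fs. fprod G)"
proof
  let ?h = "\<lambda>A'. (F - A) \<union> A'"
  have disj: "(F - A) \<inter> A' = {}" if "A' \<in> As" for A'
    using matching_replace(1)[OF F] As[OF that] by blast
  \<comment> \<open>Different replacements give different matchings, so the sum may run over the
    image of \<open>As\<close> as a set.\<close>
  have inj: "inj_on ?h As"
  proof (rule inj_onI)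
    fix A1 A2 assume "A1 \<in> As" "A2 \<in> As" "?h A1 = ?h A2"
    then show "A1 = A2" using disj[of A1] disj[of A2] by blast
  qed
  have fin: "finite F" "finite A"
    using F matching_finite finite_subset by blast+
  show "finite (?h ` As)" using \<open>finite As\<close> by simp
  show "matching n G \<and> card G = card F \<and> (G, F) \<in> root_order n" if "G \<in> ?h ` As" for G
  proof -
    from that obtain A' where A': "A' \<in> As" "G = ?h A'" by blast
    have "(?h A', (F - A) \<union> A) \<in> root_order n"
      using As[OF A'(1)] disj[OF A'(1)] fin by (intro root_order_Un) (auto dest: matching_finite)
    moreover have "(F - A) \<union> A = F" using F(2) by blast
    ultimately show ?thesis
      using A' As[OF A'(1)] matching_replace(2,3)[OF F] by auto
  qed
  have "fprod F = fprod (F - A) * fprod A"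
    unfolding fprod_def by (rule prod.subset_diff[OF F(2) fin(1)])
  also have "\<dots> = (\<Sum>A'\<in>As. fprod (F - A) * fprod A')"
    by (simp add: sum sum_distrib_left)
  also have "\<dots> = (\<Sum>A'\<in>As. fprod (?h A'))"
    unfolding fprod_def using As fin disj
    by (intro sum.cong refl prod.union_disjoint[symmetric]) (auto dest: matching_finite)
  also have "\<dots> = (\<Sum>G\<in>?h ` As. fprod G)"
    by (simp add: sum.reindex[OF inj])
  finally show "fprod F = (\<Sum>G\<in>?h ` As. fprod G)" .
qed

text \<open>The rearrangement inequality \<open>(j - i) * (s - r) > 0\<close>; it makes the second
  sum in \<open>root_order\<close> drop when a crossing is turned into a nesting.\<close>

lemma nonnested_product_less:
  fixes i j r s :: nat
  assumes "i < j" "r < s"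
  shows "i * s + j * r < i * r + j * s"
proof -
  obtain p q where "j = i + p" "s = r + q" "0 < p" "0 < q"
    using assms less_imp_add_positive by metis
  then show ?thesis by (simp add: algebra_simps)
qed

lemma expand_defect:
  assumes F: "matching n F" "defect n F"
  obtains Fs where "finite Fs" "\<And>G. G \<in> Fs \<Longrightarrow> matching n G \<and> card G = card F \<and> (G, F) \<in> root_order n"
    "fprod F = (\<Sum>G\<in>Fs. fprod G)"
proof -
  from F(2) show thesis
    unfolding defect_def
  proof (elim disjE exE conjE)
    fix i j r s a b
    assume crossing: "i < j" "j < r" "r < s" "(i, r, a) \<in> F" "(j, s, b) \<in> F"
    \<comment> \<open>If \<open>a\<close> and \<open>b\<close> stand for the signs \<open>d\<close>
      and \<open>e\<close>, the new factor must be \<open>x_i - d e x_s\<close>: this cancels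
      \<open>x_j x_s\<close> and yields \<open>d e x_r x_s\<close>.\<close>
    define c where "c = (if a = b then Antisymm else Symm)"
    have "1 \<le> i" "s \<le> n"
      using matchingD[OF F(1)] crossing(4,5) by fastforce+
    note ord = crossing(1-3) this
    show thesis
    proof (rule expand_locally[OF F(1), of "{(i, r, a), (j, s, b)}"
          "{{(i, j, a), (r, s, b)}, {(i, s, c), (j, r, Antisymm)}}"])
      show "fprod {(i, r, a), (j, s, b)} =
          (\<Sum>A'\<in>{{(i, j, a), (r, s, b)}, {(i, s, c), (j, r, Antisymm)}}. fprod A')"
        using ord by (cases a; cases b) (auto simp: c_def fprod_def doubleton_eq_iff algebra_simps)
      fix A' assume "A' \<in> {{(i, j, a), (r, s, b)}, {(i, s, c), (j, r, Antisymm)}}"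
      then show "matching n A' \<and> card A' = card {(i, r, a), (j, s, b)} \<and>
          all_indices A' \<subseteq> all_indices {(i, r, a), (j, s, b)} \<union> {j. unused n F j} \<and>
          (A', {(i, r, a), (j, s, b)}) \<in> root_order n"
        using ord nonnested_product_less[of i j r s]
        by (auto simp: matching_def all_indices_def root_order_def)
    qed (use crossing that in auto)
  next
    fix i j r s a
    assume nested: "i < j" "j < r" "r < s" "(i, s, a) \<in> F" "(j, r, Symm) \<in> F"
    \<comment> \<open>With \<open>e\<close> the sign of \<open>a\<close>, \<open>(x_i + e x_s)(x_j +
      x_r) = (x_i - e x_s)(x_j - x_r) + (x_i + x_j)(x_r + e x_s) + (x_i - x_j)(x_r - e x_s)\<close>.
      The first term descends only in the third sum, from at least \<open>j\<close> to at most
      \<open>i\<close>.\<close>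
    define c where "c = (if a = Symm then Antisymm else Symm)"
    have "1 \<le> i" "s \<le> n"
      using matchingD[OF F(1)] nested(4) by fastforce+
    note ord = nested(1-3) this
    let ?As = "{{(i, s, c), (j, r, Antisymm)}, {(i, j, Symm), (r, s, a)}, {(i, j, Antisymm), (r, s, c)}}"
    show thesis
    proof (rule expand_locally[OF F(1), of "{(i, s, a), (j, r, Symm)}" ?As])
      show "fprod {(i, s, a), (j, r, Symm)} = (\<Sum>A'\<in>?As. fprod A')"
        using ord by (cases a) (auto simp: c_def fprod_def doubleton_eq_iff algebra_simps)
      fix A' assume "A' \<in> ?As"
      then show "matching n A' \<and> card A' = card {(i, s, a), (j, r, Symm)} \<and>
          all_indices A' \<subseteq> all_indices {(i, s, a), (j, r, Symm)} \<union> {j. unused n F j} \<and>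
          (A', {(i, s, a), (j, r, Symm)}) \<in> root_order n"
        using ord by (auto simp: matching_def all_indices_def root_order_def c_def)
    qed (use nested that in auto)
  next
    fix i j r a
    assume inside: "i < j" "j < r" "(i, r, a) \<in> F" "unused n F j"
    have "1 \<le> i" "r \<le> n"
      using matchingD[OF F(1) inside(3)] by auto
    note ord = inside(1,2) this
    \<comment> \<open>\<open>x_i + e x_r = (x_i - x_j) + (x_j + e x_r)\<close>: the first term
      shortens the edge, the second moves its left end to the right.\<close>
    let ?As = "{{(i, j, Antisymm)}, {(j, r, a)}}"
    show thesis
    proof (rule expand_locally[OF F(1), of "{(i, r, a)}" ?As])
      show "fprod {(i, r, a)} = (\<Sum>A'\<in>?As. fprod A')"
        using ord by (cases a) (auto simp: fprod_def)
      fix A' assume "A' \<in> ?As"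
      then show "matching n A' \<and> card A' = card {(i, r, a)} \<and>
          all_indices A' \<subseteq> all_indices {(i, r, a)} \<union> {j. unused n F j} \<and>
          (A', {(i, r, a)}) \<in> root_order n"
        using ord inside(4) by (auto simp: matching_def all_indices_def root_order_def)
    qed (use inside that in auto)
  next
    fix i j r
    assume right: "i < j" "j < r" "(i, j, Symm) \<in> F" "unused n F r"
    have "1 \<le> i" "r \<le> n"
      using matchingD[OF F(1) right(3)] right(4) by (auto simp: unused_def)
    note ord = right(1,2) this
    \<comment> \<open>\<open>x_i + x_j = (x_i - x_j) + (x_j - x_r) + (x_j + x_r)\<close>: the first
      term changes only the kind and descends since \<open>1 \<le> i\<close>; the others have a
      larger left end.\<close>
    let ?As = "{{(i, j, Antisymm)}, {(j, r, Antisymm)}, {(j, r, Symm)}}"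
    show thesis
    proof (rule expand_locally[OF F(1), of "{(i, j, Symm)}" ?As])
      show "fprod {(i, j, Symm)} = (\<Sum>A'\<in>?As. fprod A')"
        using ord by (auto simp: fprod_def)
      fix A' assume "A' \<in> ?As"
      then show "matching n A' \<and> card A' = card {(i, j, Symm)} \<and>
          all_indices A' \<subseteq> all_indices {(i, j, Symm)} \<union> {j. unused n F j} \<and>
          (A', {(i, j, Symm)}) \<in> root_order n"
        using ord right(4) by (auto simp: matching_def all_indices_def root_order_def)
    qed (use right that in auto)
  qed
qed

text \<open>Well-founded induction along \<open>root_order\<close>: \<open>expand_defect\<close> has
  all coefficients 1, so merging the expansions of its summands only adds natural numbers.\<close>

lemma fprod_nat_combination:
  assumes "matching n F"
  shows "\<exists>c :: qpoly \<Rightarrow> nat. fprod F = (\<Sum>u\<in>B n (card F). scaleQ (of_nat (c u)) u)"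
  using assms
proof (induction F rule: wf_induct_rule[OF wf_root_order[of n]])
  case (1 F)
  show ?case
  proof (cases "defect n F")
    case True
    obtain Fs where Fs: "finite Fs"
      "\<And>G. G \<in> Fs \<Longrightarrow> matching n G \<and> card G = card F \<and> (G, F) \<in> root_order n"
      "fprod F = (\<Sum>G\<in>Fs. fprod G)"
      using expand_defect[OF 1(2) True] by blast
    have "\<forall>G\<in>Fs. \<exists>c :: qpoly \<Rightarrow> nat. fprod G = (\<Sum>u\<in>B n (card F). scaleQ (of_nat (c u)) u)"
    proof
      fix G assume "G \<in> Fs"
      then show "\<exists>c :: qpoly \<Rightarrow> nat. fprod G = (\<Sum>u\<in>B n (card F). scaleQ (of_nat (c u)) u)"
        using 1(1)[of G] Fs(2)[of G] by simp
    qed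
    then obtain c :: "root_factor set \<Rightarrow> qpoly \<Rightarrow> nat"
      where c: "\<And>G. G \<in> Fs \<Longrightarrow> fprod G = (\<Sum>u\<in>B n (card F). scaleQ (of_nat (c G u)) u)"
      by metis
    have "fprod F = (\<Sum>G\<in>Fs. \<Sum>u\<in>B n (card F). scaleQ (of_nat (c G u)) u)"
      using Fs(3) c by simp
    also have "\<dots> = (\<Sum>u\<in>B n (card F). scaleQ (of_nat (\<Sum>G\<in>Fs. c G u)) u)"
      by (subst sum.swap) (simp add: qpoly.scale_sum_left)
    finally show ?thesis by (rule exI[of _ "\<lambda>u. \<Sum>G\<in>Fs. c G u"])
  next
    case False
    then have "fprod F \<in> B n (card F)" using 1(2) by (auto simp: B_eq)
    then have "fprod F = (\<Sum>u\<in>B n (card F). scaleQ (of_nat (of_bool (u = fprod F))) u)"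
      using finite_B by (subst sum.remove[of _ "fprod F"]) auto
    then show ?thesis by (rule exI[of _ "\<lambda>u. of_bool (u = fprod F)"])
  qed
qed

section \<open>Labels of defect-free matchings\<close>

text \<open>\<open>defect_inside\<close> shows that \<open>m\<close> is used,
  \<open>defect_crossing\<close> that its edge is nested in the outer one, and
  \<open>defect_nested\<close> that this edge is not symmetric.\<close>

lemma defect_free_interior:
  assumes F: "matching n F" "\<not> defect n F" and ij: "(i, j, s) \<in> F" and m: "i < m" "m < j"
  obtains p q where "(p, q, Antisymm) \<in> F" "i < p" "q < j" "m = p \<or> m = q"
proof -
  have "m \<in> {1..n}"
    using matchingD[OF F(1) ij] m by auto
  moreover have "\<not> unused n F m"
    using F(2) defect_inside[OF ij _ m] by blast
  ultimately obtain p q t where f: "(p, q, t) \<in> F" "m = p \<or> m = q"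
    unfolding unused_def by fastforce
  have pq: "p < q" using matchingD[OF F(1) f(1)] by simp
  have "(p, q, t) \<noteq> (i, j, s)" using f(2) m by auto
  then have "factor_indices (p, q, t) \<inter> factor_indices (i, j, s) = {}"
    using F(1) f(1) ij unfolding matching_def by blast
  then have ne: "p \<noteq> i" "q \<noteq> j" by auto
  have cross: "\<not> (p < i \<and> i < q \<and> q < j)" "\<not> (i < p \<and> p < j \<and> j < q)"
    using F(2) defect_crossing[OF f(1) ij] defect_crossing[OF ij f(1)] by blast+
  have "i < p" "q < j"
    using f(2) m pq ne cross by auto
  moreover from this have "t \<noteq> Symm"
    using F(2) defect_nested[OF ij _ _ pq] f(1) by blast
  then have "t = Antisymm" using kind.exhaust by blast
  ultimately show thesis using that f by blast
qed

text \<open>Infinite descent: two different partners of the same right endpoint \<open>j\<close> produce two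
  different partners of a smaller right endpoint.\<close>

lemma antisymm_partner_le:
  assumes F: "matching n F" "\<not> defect n F" and G: "matching n G" "\<not> defect n G"
    and right: "\<And>j. (\<exists>i. (i, j, Antisymm) \<in> F) \<longleftrightarrow> (\<exists>i. (i, j, Antisymm) \<in> G)"
  shows "(i, j, Antisymm) \<in> F \<Longrightarrow> (i', j, Antisymm) \<in> G \<Longrightarrow> i' \<le> i"
proof (induction j arbitrary: i i' rule: less_induct)
  case (less j)
  show ?case
  proof (rule ccontr)
    assume "\<not> i' \<le> i"
    then have "i < i'" by simp
    have "i' < j" using matchingD(2)[OF G(1) less.prems(2)] by simp
    obtain p q where pq: "(p, q, Antisymm) \<in> F" "q < j" "i' = p \<or> i' = q"
      using defect_free_interior[OF F less.prems(1) \<open>i < i'\<close> \<open>i' < j\<close>] by blast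
    \<comment> \<open>\<open>q\<close> closes an antisymmetric factor in \<open>G\<close> as well,
      whereas \<open>i'\<close> is a left endpoint there.\<close>
    have "i' \<noteq> q"
    proof
      assume "i' = q"
      then obtain x where "(x, i', Antisymm) \<in> G" using right pq(1) by blast
      then show False using matching_inj(3)[OF G(1) less.prems(2)] by fastforce
    qed
    then have q: "(i', q, Antisymm) \<in> F" using pq by blast
    then obtain i'' where i'': "(i'', q, Antisymm) \<in> G" using right by blast
    have "i' < q" using matchingD(2)[OF F(1) q] by simp
    \<comment> \<open>In \<open>G\<close> the edge ending at \<open>q\<close> lies inside the edge
      from \<open>i'\<close> to \<open>j\<close>, so \<open>i' < i''\<close>; the induction
      hypothesis at \<open>q\<close> gives \<open>i'' \<le> i'\<close>.\<close>
    obtain p2 q2 where pq2: "(p2, q2, Antisymm) \<in> G" "i' < p2" "q = p2 \<or> q = q2"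
      using defect_free_interior[OF G less.prems(2) \<open>i' < q\<close> \<open>q < j\<close>] by blast
    have "q = q2"
      using matching_inj(3)[OF G(1) pq2(1) i''] pq2(3) by auto
    then have "p2 = i''"
      using inj_onD[OF matching_inj(2)[OF G(1)] _ pq2(1) i''] by simp
    then show False
      using less.IH[OF \<open>q < j\<close> q i''] pq2(2) by simp
  qed
qed

section \<open>Symmetric factors of defect-free matchings\<close>

lemma all_indices_iff:
  "x \<in> all_indices F \<longleftrightarrow> (\<exists>i j s. (i, j, s) \<in> F \<and> (x = i \<or> x = j))"
proof
  assume "x \<in> all_indices F"
  then obtain f where "f \<in> F" "x \<in> factor_indices f" unfolding all_indices_def by blast
  then show "\<exists>i j s. (i, j, s) \<in> F \<and> (x = i \<or> x = j)" by (cases f) auto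
qed (force simp: all_indices_def)

lemma matching_mono: "matching n F \<Longrightarrow> G \<subseteq> F \<Longrightarrow> matching n G"
  unfolding matching_def by blast

lemma card_all_indices:
  assumes "matching n F"
  shows "card (all_indices F) = 2 * card F"
proof -
  have "card (all_indices F) = (\<Sum>f\<in>F. card (factor_indices f))"
    unfolding all_indices_def
    using assms by (intro card_UN_disjoint matching_finite) (auto simp: matching_def factor_indices_eq)
  also have "\<dots> = (\<Sum>f\<in>F. 2)"
    using matchingD(2)[OF assms] by (intro sum.cong refl) (force simp: factor_indices_eq)
  finally show ?thesis by simp
qed

definition of_kind :: "kind \<Rightarrow> root_factor set \<Rightarrow> root_factor set"
  where "of_kind s F = {f \<in> F. snd (snd f) = s}"

lemma mem_of_kind [simp]: "(i, j, t) \<in> of_kind s F \<longleftrightarrow> (i, j, t) \<in> F \<and> t = s"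
  by (auto simp: of_kind_def)

lemma card_of_kind: "finite F \<Longrightarrow> card F = card (of_kind Symm F) + card (of_kind Antisymm F)"
  by (subst card_Un_disjoint[symmetric])
    (auto simp: of_kind_def intro: kind.exhaust intro!: arg_cong[of _ _ card])

lemma kind_indices_disjoint:
  assumes "matching n F"
  shows "all_indices (of_kind Symm F) \<inter> all_indices (of_kind Antisymm F) = {}"
proof (rule equals0I)
  fix x assume "x \<in> all_indices (of_kind Symm F) \<inter> all_indices (of_kind Antisymm F)"
  then obtain i j p q where "(i, j, Symm) \<in> F" "x = i \<or> x = j" "(p, q, Antisymm) \<in> F" "x = p \<or> x = q"
    unfolding all_indices_iff mem_of_kind Int_iff by blast
  then show False
    using matching_eq[OF assms, of "(i, j, Symm)" "(p, q, Antisymm)" x] by simp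
qed

lemma symm_indices_upward_closed:
  assumes F: "matching n F" "\<not> defect n F" and x: "x \<in> all_indices (of_kind Symm F)"
    and y: "y \<in> {1..n}" "y \<notin> all_indices (of_kind Antisymm F)" "x < y"
  shows "y \<in> all_indices (of_kind Symm F)"
proof (rule ccontr)
  assume "y \<notin> all_indices (of_kind Symm F)"
  then have not: "y \<noteq> p \<and> y \<noteq> q" if "(p, q, s) \<in> F" for p q s
    using y(2) that by (cases s) (auto simp: all_indices_iff)
  then have "unused n F y"
    using y(1) by (fastforce simp: unused_def)
  obtain i j where ij: "(i, j, Symm) \<in> F" "x = i \<or> x = j"
    using x unfolding all_indices_iff mem_of_kind by blast
  have "i < j" "y \<noteq> j" using matchingD(2)[OF F(1) ij(1)] not[OF ij(1)] by auto
  then have "i < y \<and> y < j \<or> j < y" using ij(2) y(3) by auto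
  then show False
    using F(2) defect_inside[OF ij(1) \<open>unused n F y\<close>] defect_right[OF ij(1) \<open>unused n F y\<close> \<open>i < j\<close>]
    by blast
qed

text \<open>Two final segments of the same set are comparable, and these two have the same size,
  twice the number of symmetric factors.\<close>

lemma symm_indices_subset:
  assumes F: "matching n F" "\<not> defect n F" and G: "matching n G" "\<not> defect n G"
    and card: "card F = card G" and anti: "of_kind Antisymm F = of_kind Antisymm G"
  shows "all_indices (of_kind Symm F) \<subseteq> all_indices (of_kind Symm G)" (is "?SF \<subseteq> ?SG")
proof (rule ccontr)
  have sub: "of_kind s H \<subseteq> H" for s H by (auto simp: of_kind_def)
  have mem: "x \<in> {1..n} \<and> x \<notin> all_indices (of_kind Antisymm H)"
    if "matching n H" "x \<in> all_indices (of_kind Symm H)" for H x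
  proof
    show "x \<notin> all_indices (of_kind Antisymm H)"
      using kind_indices_disjoint[OF that(1)] that(2) by blast
    show "x \<in> {1..n}"
      using that(2) matchingD[OF that(1)] unfolding all_indices_iff mem_of_kind by fastforce
  qed
  assume "\<not> ?SF \<subseteq> ?SG"
  then obtain x where x: "x \<in> ?SF" "x \<notin> ?SG" by blast
  have "y \<in> ?SF" if y: "y \<in> ?SG" for y
  proof -
    consider "x < y" | "y < x" using x y by (metis linorder_neqE_nat)
    then show ?thesis
    proof cases
      case 1
      then show ?thesis
        using symm_indices_upward_closed[OF F x(1), of y] mem[OF G(1) y] anti by simp
    next
      case 2
      then show ?thesis
        using symm_indices_upward_closed[OF G y, of x] mem[OF F(1) x(1)] anti x(2) by simp
    qed
  qed
  then have "?SG \<subset> ?SF" using x by blast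
  moreover have "finite ?SF"
    using mem[OF F(1)] by (intro finite_subset[of ?SF "{1..n}"]) auto
  ultimately have "card ?SG < card ?SF" by (intro psubset_card_mono)
  moreover have "card (of_kind Symm F) = card (of_kind Symm G)"
    using card_of_kind[OF matching_finite[OF F(1)]] card_of_kind[OF matching_finite[OF G(1)]] card anti
    by simp
  ultimately show False
    using card_all_indices[OF matching_mono[OF F(1) sub]] card_all_indices[OF matching_mono[OF G(1) sub]]
    by simp
qed

text \<open>Induction on \<open>j\<close> from the right. If \<open>j\<close> were a left endpoint
  in \<open>G\<close>, its factor would end further right and, by the hypothesis with
  \<open>F\<close> and \<open>G\<close> exchanged, lie in \<open>F\<close>, where \<open>j\<close>
  is a right endpoint. If the left partners of \<open>j\<close> differed, the larger one would lie
  inside the edge of the other, hence in an antisymmetric factor.\<close>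

lemma symm_factor_transfer:
  assumes "matching n F" "\<not> defect n F" "matching n G" "\<not> defect n G"
    and "of_kind Antisymm F = of_kind Antisymm G"
    and "all_indices (of_kind Symm F) = all_indices (of_kind Symm G)"
    and "(i, j, Symm) \<in> F"
  shows "(i, j, Symm) \<in> G"
  using assms
proof (induction "n - j" arbitrary: i j F G rule: less_induct)
  case less
  note F = less.prems(1,2) and G = less.prems(3,4) and anti = less.prems(5) and ij = less.prems(7)
  have between: False if H: "matching n H" "\<not> defect n H" "matching n K" "of_kind Antisymm H = of_kind Antisymm K"
    and ab: "(a, j, Symm) \<in> H" "(b, j, Symm) \<in> K" "a < b" for H K a b
  proof -
    have "b < j" using matchingD(2)[OF H(3) ab(2)] by simp
    obtain p q where "(p, q, Antisymm) \<in> H" "b = p \<or> b = q"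
      using defect_free_interior[OF H(1,2) ab(1,3) \<open>b < j\<close>] by blast
    then have "b \<in> all_indices (of_kind Antisymm K)"
      unfolding H(4)[symmetric] all_indices_iff mem_of_kind by blast
    moreover have "b \<in> all_indices (of_kind Symm K)"
      using ab(2) unfolding all_indices_iff mem_of_kind by blast
    ultimately show False using kind_indices_disjoint[OF H(3)] by blast
  qed
  have "j \<in> all_indices (of_kind Symm G)"
    using ij unfolding less.prems(6)[symmetric] all_indices_iff mem_of_kind by blast
  then obtain p q where pq: "(p, q, Symm) \<in> G" "j = p \<or> j = q"
    unfolding all_indices_iff mem_of_kind by blast
  show ?case
  proof (cases "j = q")
    case True
    then show ?thesis
      using pq ij between[OF F G(1) anti] between[OF G F(1) anti[symmetric]]
      by (metis linorder_neqE_nat)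
  next
    case False
    then have jq: "(j, q, Symm) \<in> G" using pq by blast
    have "n - q < n - j" using matchingD[OF G(1) jq] by auto
    then have "(j, q, Symm) \<in> F"
      using less.hyps[of q G F j] F G anti less.prems(6) jq by simp
    then show ?thesis
      using matching_inj(3)[OF F(1) _ ij] by fastforce
  qed
qed

section \<open>Closing brackets and injectivity of the labelling\<close>

definition is_close :: "root_factor set \<Rightarrow> nat \<Rightarrow> bool"
  where "is_close F j \<longleftrightarrow> (\<exists>i<j. (i, j, Antisymm) \<in> F)"

lemma label_fprod:
  "matching n F \<Longrightarrow> label n (card F) (fprod F) = map (\<lambda>j. if is_close F j then 2 else 1) [1..<n+1]"
  by (simp add: label_def normal_form_fprod is_close_def)

lemma is_close_iff: "matching n F \<Longrightarrow> is_close F j \<longleftrightarrow> (\<exists>i. (i, j, Antisymm) \<in> F)"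
  using matchingD(2) unfolding is_close_def by fastforce

lemma is_close_range: "matching n F \<Longrightarrow> is_close F j \<Longrightarrow> j \<in> {1..n}"
  using matchingD(3) unfolding is_close_def by fastforce

text \<open>The label gives the right endpoints of the antisymmetric factors, these give the
  factors; together with \<open>card F\<close> they fix the symmetric indices and then their
  pairing.\<close>

lemma label_inject_subset:
  assumes F: "matching n F" "\<not> defect n F" and G: "matching n G" "\<not> defect n G"
    and card: "card F = card G" and lab: "label n (card F) (fprod F) = label n (card G) (fprod G)"
  shows "F \<subseteq> G"
proof -
  have "\<forall>j\<in>set [1..<n+1]. (if is_close F j then 2 else 1) = (if is_close G j then 2 else 1 :: nat)"
    using lab by (simp only: label_fprod[OF F(1)] label_fprod[OF G(1)] map_eq_conv)
  then have eq: "(if is_close F j then 2 else 1) = (if is_close G j then 2 else 1 :: nat)"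
    if "j \<in> {1..n}" for j
    using that by (simp del: upt_Suc)
  have "is_close F j \<longleftrightarrow> is_close G j" for j
  proof (cases "j \<in> {1..n}")
    case True
    then show ?thesis using eq[OF True] by (cases "is_close F j"; cases "is_close G j") simp_all
  next
    case False
    then show ?thesis using is_close_range[OF F(1), of j] is_close_range[OF G(1), of j] by blast
  qed
  then have right: "(\<exists>i. (i, j, Antisymm) \<in> F) \<longleftrightarrow> (\<exists>i. (i, j, Antisymm) \<in> G)" for j
    unfolding is_close_iff[OF F(1), symmetric] is_close_iff[OF G(1), symmetric] by simp
  have unique: "i = i'" if "(i, j, Antisymm) \<in> F" "(i', j, Antisymm) \<in> G" for i i' j
    using antisymm_partner_le[OF F G right that] antisymm_partner_le[OF G F right[symmetric] that(2,1)]
    by simp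
  have anti_iff: "(i, j, Antisymm) \<in> F \<longleftrightarrow> (i, j, Antisymm) \<in> G" for i j
    using right[of j] unique by blast
  then have anti: "of_kind Antisymm F = of_kind Antisymm G"
    unfolding of_kind_def by force
  have "all_indices (of_kind Symm F) = all_indices (of_kind Symm G)"
    using symm_indices_subset[OF F G card anti] symm_indices_subset[OF G F card[symmetric] anti[symmetric]]
    by blast
  then have symm: "(i, j, Symm) \<in> F \<Longrightarrow> (i, j, Symm) \<in> G" for i j
    using symm_factor_transfer[OF F G anti] by blast
  show ?thesis
  proof
    fix f assume "f \<in> F"
    then show "f \<in> G"
      using symm anti_iff
      by (cases f rule: factor_poly.cases) auto
  qed
qed

lemma inj_on_label: "inj_on (label n k) (B n k)"
proof (rule inj_onI)
  fix u v assume "u \<in> B n k" "v \<in> B n k" "label n k u = label n k v"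
  then obtain F G where "matching n F" "\<not> defect n F" "card F = k" "u = fprod F"
    "matching n G" "\<not> defect n G" "card G = k" "v = fprod G"
    by (auto simp: B_eq)
  then show "u = v"
    using label_inject_subset[of n F G] label_inject_subset[of n G F] \<open>label n k u = label n k v\<close>
    by auto
qed

section \<open>Lattice words\<close>

lemma count_list_map_upt: "count_list (map g [1..<m+1]) x = card {j \<in> {1..m}. g j = x}"
proof (induction m)
  case (Suc m)
  have "{j \<in> {1..Suc m}. g j = x} = {j \<in> {1..m}. g j = x} \<union> (if g (Suc m) = x then {Suc m} else {})"
    by (auto simp: le_Suc_eq)
  then show ?case
    using Suc by (simp add: card_Un_disjoint)
qed simp

text \<open>Sending each closing index to its left partner injects the 2s of any prefix into its 1s:
  partners lie further left, and a left endpoint is never closing.\<close>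

lemma label_in_lattice_words:
  assumes F: "matching n F"
  shows "label n (card F) (fprod F) \<in> lattice_words n (card F)"
proof -
  let ?g = "\<lambda>j. if is_close F j then 2 else 1 :: nat"
  have two: "card {j \<in> {1..m}. ?g j = 2} = card {j \<in> {1..m}. is_close F j}" for m
    by (rule arg_cong[of _ _ card]) auto
  have one: "card {j \<in> {1..m}. ?g j = 1} = card {j \<in> {1..m}. \<not> is_close F j}" for m
    by (rule arg_cong[of _ _ card]) auto
  have take: "take m (map ?g [1..<n+1]) = map ?g [1..<m+1]" if "m \<le> n" for m
    using that by (simp add: take_map take_upt del: upt_Suc)
  define p where "p = (\<lambda>j. SOME i. (i, j, Antisymm) \<in> F)"
  have p: "(p j, j, Antisymm) \<in> F" if "is_close F j" for j
    using that unfolding is_close_iff[OF F] p_def by (rule someI_ex)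
  have balanced: "card {j \<in> {1..m}. is_close F j} \<le> card {j \<in> {1..m}. \<not> is_close F j}" for m
  proof (rule card_inj_on_le[of p])
    show "inj_on p {j \<in> {1..m}. is_close F j}"
    proof (rule inj_onI)
      fix j j' assume "j \<in> {j \<in> {1..m}. is_close F j}" "j' \<in> {j \<in> {1..m}. is_close F j}" "p j = p j'"
      then show "j = j'"
        using inj_onD[OF matching_inj(1)[OF F] _ p[of j] p[of j']] by simp
    qed
    show "p ` {j \<in> {1..m}. is_close F j} \<subseteq> {j \<in> {1..m}. \<not> is_close F j}"
    proof clarify
      fix j assume j: "j \<in> {1..m}" "is_close F j"
      have "\<not> is_close F (p j)"
        using matching_inj(3)[OF F p[OF j(2)]] unfolding is_close_iff[OF F] by fastforce
      then show "p j \<in> {1..m} \<and> \<not> is_close F (p j)"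
        using matchingD[OF F p[OF j(2)]] j(1) by auto
    qed
  qed simp
  have closes: "card {j \<in> {1..n}. is_close F j} \<le> card F"
  proof -
    have "{j \<in> {1..n}. is_close F j} \<subseteq> rgt ` F"
      using p by force
    then have "card {j \<in> {1..n}. is_close F j} \<le> card (rgt ` F)"
      using matching_finite[OF F] by (intro card_mono) auto
    also have "\<dots> \<le> card F" using matching_finite[OF F] by (rule card_image_le)
    finally show ?thesis .
  qed
  show ?thesis
    unfolding label_fprod[OF F] lattice_words_def
  proof (intro CollectI conjI allI impI)
    show "count_list (take m (map ?g [1..<n+1])) 2 \<le> count_list (take m (map ?g [1..<n+1])) 1"
      if "m \<le> n" for m
      unfolding take[OF that] count_list_map_upt one two by (rule balanced)
    show "count_list (map ?g [1..<n+1]) 2 \<le> card F"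
      unfolding count_list_map_upt two by (rule closes)
  qed auto
qed

section \<open>Counting lattice words by their last letter\<close>

lemma finite_lattice_words: "finite (lattice_words n k)"
  by (rule finite_subset[OF _ finite_lists_length_eq[of "{1, 2}" n]]) (auto simp: lattice_words_def)

lemma lattice_words_snoc_iff:
  "w @ [x] \<in> lattice_words (Suc n) k \<longleftrightarrow> length w = n \<and> set w \<subseteq> {1, 2} \<and> x \<in> {1, 2} \<and>
    (\<forall>m\<le>n. count_list (take m w) 2 \<le> count_list (take m w) 1) \<and>
    count_list w 2 + of_bool (x = 2) \<le> count_list w 1 + of_bool (x = 1) \<and>
    count_list w 2 + of_bool (x = 2) \<le> k"
proof -
  have "(\<forall>m\<le>Suc n. count_list (take m (w @ [x])) 2 \<le> count_list (take m (w @ [x])) 1) \<longleftrightarrow>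
      (\<forall>m\<le>n. count_list (take m w) 2 \<le> count_list (take m w) 1) \<and>
      count_list w 2 + of_bool (x = 2) \<le> count_list w 1 + of_bool (x = 1)" if "length w = n"
    using that by (auto simp: le_Suc_eq)
  then show ?thesis
    by (auto simp: lattice_words_def)
qed

lemma lattice_word_counts:
  assumes "w \<in> lattice_words n k"
  shows "count_list w 2 \<le> count_list w 1" "count_list w 1 + count_list w 2 = n"
proof -
  show "count_list w 2 \<le> count_list w 1"
    using assms by (auto simp: lattice_words_def dest: spec[of _ n])
  have "count_list w 1 + count_list w 2 = length w" if "set w \<subseteq> {1, 2}" for w :: "nat list"
    using that by (induction w) auto
  then show "count_list w 1 + count_list w 2 = n"
    using assms by (auto simp: lattice_words_def)
qed

lemma lattice_words_Suc_0: "lattice_words (Suc n) 0 = (\<lambda>w. w @ [1]) ` lattice_words n 0"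
proof (intro set_eqI iffI)
  fix v assume v: "v \<in> lattice_words (Suc n) 0"
  then obtain w x where "v = w @ [x]"
    by (cases v rule: rev_cases) (auto simp: lattice_words_def)
  then show "v \<in> (\<lambda>w. w @ [1]) ` lattice_words n 0"
    using v by (auto simp: lattice_words_snoc_iff) (auto simp: lattice_words_def)
next
  fix v assume "v \<in> (\<lambda>w. w @ [1]) ` lattice_words n 0"
  then obtain w where "w \<in> lattice_words n 0" "v = w @ [1]" by blast
  moreover from this have "w @ [1] \<in> lattice_words (Suc n) 0"
    using lattice_word_counts[of w n 0] unfolding lattice_words_snoc_iff
    by (auto simp: lattice_words_def)
  ultimately show "v \<in> lattice_words (Suc n) 0" by simp
qed

text \<open>Appending a 2 stays within lattice words because at most \<open>k\<close> 2s among at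
  least \<open>2 * k + 1\<close> letters leave a strict majority of 1s.\<close>

lemma lattice_words_Suc_Suc:
  assumes "2 * Suc k \<le> Suc n"
  shows "lattice_words (Suc n) (Suc k) =
    (\<lambda>w. w @ [1]) ` lattice_words n (Suc k) \<union> (\<lambda>w. w @ [2]) ` lattice_words n k"
proof (intro set_eqI iffI)
  fix v assume v: "v \<in> lattice_words (Suc n) (Suc k)"
  then obtain w x where w: "v = w @ [x]"
    by (cases v rule: rev_cases) (auto simp: lattice_words_def)
  then have "x = 1 \<and> w \<in> lattice_words n (Suc k) \<or> x = 2 \<and> w \<in> lattice_words n k"
    using v by (auto simp: lattice_words_snoc_iff) (auto simp: lattice_words_def)
  with w show "v \<in> (\<lambda>w. w @ [1]) ` lattice_words n (Suc k) \<union> (\<lambda>w. w @ [2]) ` lattice_words n k"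
    by blast
next
  fix v assume "v \<in> (\<lambda>w. w @ [1]) ` lattice_words n (Suc k) \<union> (\<lambda>w. w @ [2]) ` lattice_words n k"
  then consider w where "w \<in> lattice_words n (Suc k)" "v = w @ [1]"
    | w where "w \<in> lattice_words n k" "v = w @ [2]" by blast
  then show "v \<in> lattice_words (Suc n) (Suc k)"
  proof cases
    case 1
    then show ?thesis
      using lattice_word_counts[OF 1(1)] unfolding 1(2) lattice_words_snoc_iff
      by (auto simp: lattice_words_def)
  next
    case 2
    have "count_list w 2 \<le> k" using 2(1) by (simp add: lattice_words_def)
    then have "count_list w 2 < count_list w 1"
      using lattice_word_counts[OF 2(1)] assms by simp
    then show ?thesis
      using 2(1) unfolding 2(2) lattice_words_snoc_iff by (auto simp: lattice_words_def)
  qed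
qed

text \<open>At most half of the letters of a lattice word are 2s.\<close>

lemma lattice_words_Suc_eq:
  assumes "n < 2 * Suc k"
  shows "lattice_words n (Suc k) = lattice_words n k"
proof (intro set_eqI iffI)
  fix w assume w: "w \<in> lattice_words n (Suc k)"
  have "count_list w 2 \<le> k"
    using lattice_word_counts[OF w] assms by simp
  with w show "w \<in> lattice_words n k"
    unfolding lattice_words_def by blast
qed (auto simp: lattice_words_def)

text \<open>Splitting off the last letter reproduces Pascal's rule.\<close>

lemma card_lattice_words: "2 * k \<le> n \<Longrightarrow> card (lattice_words n k) = n choose k"
proof (induction n arbitrary: k)
  case 0
  then have "lattice_words 0 k = {[]}" by (auto simp: lattice_words_def)
  with 0 show ?case by simp
next
  case (Suc n)
  have inj: "inj_on (\<lambda>w. w @ [x]) A" for x :: nat and A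
    by (rule inj_onI) simp
  show ?case
  proof (cases k)
    case 0
    then show ?thesis
      using Suc.IH[of 0] by (simp add: lattice_words_Suc_0 card_image[OF inj])
  next
    case (Suc l)
    have "card (lattice_words n k) = n choose k"
    proof (cases "2 * k \<le> n")
      \<comment> \<open>Here \<open>n = 2 * l + 1\<close>, so the induction hypothesis does not
        cover \<open>k\<close>. The words for \<open>k\<close> and \<open>l\<close> coincide, and so
        do the binomial coefficients, by symmetry.\<close>
      case False
      then have "lattice_words n k = lattice_words n l"
        unfolding Suc by (intro lattice_words_Suc_eq) simp
      moreover have "n choose k = n choose l"
      proof -
        have "k \<le> n" "n - k = l" using False Suc.prems Suc by auto
        then show ?thesis using binomial_symmetric[of k n] by simp
      qed
      ultimately show ?thesis
        using Suc.IH[of l] Suc.prems Suc by simp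
    qed (use Suc.IH in blast)
    moreover have "card (lattice_words n l) = n choose l"
      using Suc.IH[of l] Suc.prems Suc by simp
    moreover have "card (lattice_words (Suc n) k) = card (lattice_words n k) + card (lattice_words n l)"
    proof -
      have "lattice_words (Suc n) k =
          (\<lambda>w. w @ [1]) ` lattice_words n k \<union> (\<lambda>w. w @ [2]) ` lattice_words n l"
        using Suc.prems unfolding Suc by (rule lattice_words_Suc_Suc)
      moreover have "(\<lambda>w. w @ [1]) ` lattice_words n k \<inter> (\<lambda>w. w @ [2]) ` lattice_words n l = {}"
        by auto
      ultimately show ?thesis
        by (simp add: card_Un_disjoint finite_lattice_words card_image[OF inj])
    qed
    ultimately show ?thesis by (simp add: Suc)
  qed
qed

section \<open>The basis of defect-free roots\<close>

text \<open>A basis chosen inside \<open>S\<close> has \<open>dim W\<close> elements, at least as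
  many as \<open>S\<close>, so nothing was discarded.\<close>

lemma independent_if_card_le_dim:
  assumes "finite S" "S \<subseteq> W" "W \<subseteq> qpoly.span S" "card S \<le> qpoly.dim W"
  shows "qpoly.independent S"
proof -
  obtain S' where S': "S' \<subseteq> S" "qpoly.independent S'" "S \<subseteq> qpoly.span S'"
    by (rule qpoly.maximal_independent_subset)
  have "W \<subseteq> qpoly.span S'"
    using assms(3) S'(3) qpoly.span_mono qpoly.span_span by blast
  then have "card S' = qpoly.dim W"
    using S' assms(2) by (intro qpoly.basis_card_eq_dim) auto
  then have "S' = S"
    using assms(1,4) S'(1) by (intro card_seteq) auto
  with S'(2) show ?thesis by simp
qed

lemma B_subset_V: "B n k \<subseteq> V n k"
  using fprod_in_V by (auto simp: B_eq)

lemma V_subset_span_B: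
  assumes "2 * k \<le> n"
  shows "V n k \<subseteq> qpoly.span (B n k)"
proof -
  have "pos_kroots n k \<subseteq> qpoly.span (B n k)"
  proof
    fix v assume "v \<in> pos_kroots n k"
    then obtain F where F: "matching n F" "card F = k" "v = fprod F" by (auto simp: pos_kroots_eq)
    then obtain c :: "qpoly \<Rightarrow> nat" where "v = (\<Sum>u\<in>B n k. scaleQ (of_nat (c u)) u)"
      using fprod_nat_combination[OF F(1)] by blast
    then show "v \<in> qpoly.span (B n k)"
      by (auto intro!: qpoly.span_sum qpoly.span_scale intro: qpoly.span_base)
  qed
  then have "qpoly.span (pos_kroots n k) \<subseteq> qpoly.span (B n k)"
    by (intro qpoly.span_minimal qpoly.subspace_span)
  then have "sqfree_monom ` ksubsets n k \<subseteq> qpoly.span (B n k)"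
    using sqfree_monom_in_span_pos_kroots[OF assms] by blast
  then show ?thesis
    unfolding V_def by (intro qpoly.span_minimal qpoly.subspace_span)
qed

lemma label_image_subset: "label n k ` B n k \<subseteq> lattice_words n k"
  using label_in_lattice_words by (auto simp: B_eq)

text \<open>Injectivity of the labels bounds the spanning set by the number of lattice words, which
  is the dimension.\<close>

lemma independent_B:
  assumes "2 * k \<le> n"
  shows "qpoly.independent (B n k)"
proof (rule independent_if_card_le_dim[OF finite_B B_subset_V V_subset_span_B[OF assms]])
  show "card (B n k) \<le> qpoly.dim (V n k)"
    using card_inj_on_le[OF inj_on_label label_image_subset finite_lattice_words, of n k]
    by (simp add: dim_V card_lattice_words[OF assms])
qed

text \<open>Surjectivity comes from counting: as a basis, \<open>B n k\<close> has as many elements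
  as there are lattice words.\<close>

lemma bij_betw_label:
  assumes "2 * k \<le> n"
  shows "bij_betw (label n k) (B n k) (lattice_words n k)"
proof -
  have "card (label n k ` B n k) = card (B n k)"
    by (rule card_image[OF inj_on_label])
  also have "\<dots> = qpoly.dim (V n k)"
    by (rule qpoly.basis_card_eq_dim[OF B_subset_V V_subset_span_B[OF assms] independent_B[OF assms]])
  also have "\<dots> = card (lattice_words n k)"
    by (simp add: dim_V card_lattice_words[OF assms])
  finally have "label n k ` B n k = lattice_words n k"
    using label_image_subset finite_lattice_words by (intro card_subset_eq)
  then show ?thesis
    using inj_on_label by (simp add: bij_betw_def)
qed

section \<open>Indecomposable positive roots\<close>

lemma defect_imp_pos_lin_comb:
  assumes "matching n F" "defect n F"
  shows "pos_lin_comb (fprod F) (pos_kroots n (card F) - {fprod F})"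
proof -
  obtain Fs where Fs: "finite Fs"
    "\<And>G. G \<in> Fs \<Longrightarrow> matching n G \<and> card G = card F \<and> (G, F) \<in> root_order n"
    "fprod F = (\<Sum>G\<in>Fs. fprod G)"
    using expand_defect[OF assms] by blast
  have inj: "inj_on fprod Fs"
    by (rule inj_onI) (use Fs(2) fprod_inject in metis)
  \<comment> \<open>The summands lie strictly below \<open>F\<close> in \<open>root_order\<close>
    and \<open>fprod\<close> is injective, so none of them is \<open>fprod F\<close>.\<close>
  have "fprod G \<in> pos_kroots n (card F) - {fprod F}" if "G \<in> Fs" for G
    using Fs(2)[OF that] fprod_inject[of n G F] assms(1) root_order_irrefl[of F n]
    by (auto simp: pos_kroots_eq)
  moreover have "fprod F = (\<Sum>u\<in>fprod ` Fs. scaleQ 1 u)"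
    using Fs(3) by (simp add: sum.reindex[OF inj])
  ultimately show ?thesis
    unfolding pos_lin_comb_def using Fs(1)
    by (intro exI[of _ "fprod ` Fs"] exI[of _ "\<lambda>_. 1"]) auto
qed

text \<open>The leading coefficient of \<open>fprod G\<close> is 1, so \<open>d\<close> is itself a
  coefficient of \<open>fprod F\<close>, hence 0, 1 or -1; only 1 remains.\<close>

lemma fprod_scaleQ_of_nat_imp_eq:
  assumes "matching n F" "matching n G" "fprod F = scaleQ (of_nat d) (fprod G)"
  shows "fprod F = fprod G"
proof -
  have fin: "finite (lft ` G)"
    using matching_finite[OF assms(2)] by simp
  have "sqfree_coeff (fprod F) (lft ` G) = of_nat d"
    unfolding assms(3) sqfree_coeff_scaleQ coeff_fprod_leading[OF assms(2)] by simp
  then have "(of_nat d :: rat) \<in> {0, 1, -1}"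
    using coeff_fprod_cases[OF assms(1) fin] by simp
  moreover have "(of_nat d :: rat) \<noteq> -1"
    by (metis of_nat_0_le_iff neg_0_le_iff_le not_one_le_zero)
  moreover have "(of_nat d :: rat) \<noteq> 0"
    using fprod_nonzero[OF assms(1)] assms(3) by auto
  ultimately have "(of_nat d :: rat) = 1" by simp
  with assms(3) show ?thesis by simp
qed

text \<open>If \<open>v\<close> is a positive combination of positive roots \<open>u\<close>, expanding each \<open>u\<close> in the basis shows,
  as no cancellation can occur, that every \<open>u\<close> is a multiple of \<open>v\<close>, hence equal to \<open>v\<close>.\<close>

lemma B_not_pos_lin_comb:
  assumes "2 * k \<le> n" and v: "v \<in> B n k"
  shows "\<not> pos_lin_comb v (pos_kroots n k - {v})"
proof
  assume "pos_lin_comb v (pos_kroots n k - {v})"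
  then obtain T c where T: "finite T" "T \<subseteq> pos_kroots n k - {v}" "\<And>u. u \<in> T \<Longrightarrow> c u > 0"
    "v = (\<Sum>u\<in>T. scaleQ (c u) u)"
    unfolding pos_lin_comb_def by blast
  have "\<exists>d :: qpoly \<Rightarrow> nat. u = (\<Sum>b\<in>B n k. scaleQ (of_nat (d b)) b)" if "u \<in> T" for u
    using T(2) that fprod_nat_combination[of n] by (auto simp: pos_kroots_eq)
  then obtain d :: "qpoly \<Rightarrow> qpoly \<Rightarrow> nat"
    where d: "\<And>u. u \<in> T \<Longrightarrow> u = (\<Sum>b\<in>B n k. scaleQ (of_nat (d u b)) b)"
    by metis
  obtain G where G: "matching n G" "v = fprod G"
    using v by (auto simp: B_eq)
  have "v = (\<Sum>u\<in>T. \<Sum>b\<in>B n k. scaleQ (c u * of_nat (d u b)) b)"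
    unfolding T(4) by (intro sum.cong refl, subst d) (simp_all add: qpoly.scale_sum_right)
  also have "\<dots> = (\<Sum>b\<in>B n k. scaleQ (\<Sum>u\<in>T. c u * of_nat (d u b)) b)"
    by (subst sum.swap) (simp add: qpoly.scale_sum_left)
  finally have v_sum: "v = (\<Sum>b\<in>B n k. scaleQ (\<Sum>u\<in>T. c u * of_nat (d u b)) b)" .
  have "(\<Sum>b\<in>B n k. scaleQ (of_bool (b = v)) b) = v"
    using v finite_B by (subst sum.remove[of _ v]) auto
  \<comment> \<open>Subtracting the trivial expansion of \<open>v\<close> leaves a relation among
    basis elements, whose coefficients vanish by independence.\<close>
  then have vanish: "(\<Sum>b\<in>B n k. scaleQ ((\<Sum>u\<in>T. c u * of_nat (d u b)) - of_bool (b = v)) b) = 0"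
    by (simp only: qpoly.scale_left_diff_distrib sum_subtractf v_sum[symmetric] diff_self)
  have coeff: "(\<Sum>u\<in>T. c u * of_nat (d u b)) - of_bool (b = v) = 0" if "b \<in> B n k" for b
    by (rule qpoly.independentD[OF independent_B[OF assms(1)] finite_B subset_refl vanish that])
  have zero: "d u b = 0" if "u \<in> T" "b \<in> B n k" "b \<noteq> v" for u b
  proof -
    \<comment> \<open>Nonnegative terms with sum 0 all vanish, and \<open>c u > 0\<close> then
      forces \<open>d u b = 0\<close>.\<close>
    have sum0: "(\<Sum>u\<in>T. c u * of_nat (d u b)) = 0" using coeff[OF that(2)] that(3) by simp
    have nonneg: "0 \<le> c w * of_nat (d w b)" if "w \<in> T" for w
      using T(3)[OF that] by simp
    have "c u * of_nat (d u b) = 0"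
      by (rule bspec[OF iffD1[OF sum_nonneg_eq_0_iff[OF T(1) nonneg] sum0] that(1)])
    then show ?thesis using T(3)[OF that(1)] by simp
  qed
  \<comment> \<open>An empty \<open>T\<close> would give \<open>v = 0\<close>.\<close>
  have "v \<noteq> 0" using fprod_nonzero G by simp
  then obtain u where u: "u \<in> T" using T(4) by fastforce
  then obtain F where F: "matching n F" "u = fprod F" using T(2) by (auto simp: pos_kroots_eq)
  have "u = (\<Sum>b\<in>B n k. scaleQ (of_nat (d u b)) b)" by (rule d[OF u])
  also have "\<dots> = scaleQ (of_nat (d u v)) v"
    using v finite_B zero[OF u] by (subst sum.remove[of _ v]) auto
  finally have "u = v"
    unfolding F(2) G(2) by (rule fprod_scaleQ_of_nat_imp_eq[OF F(1) G(1)])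
  then show False using T(2) u by blast
qed

theorem theorem3p10:
  fixes n k :: nat
  assumes "n \<ge> 2" and "2 * k \<le> n"
  shows "bij_betw (label n k) (B n k) (lattice_words n k) \<and>
    (B n k \<subseteq> V n k \<and> qpoly.independent (B n k) \<and> qpoly.span (B n k) = V n k) \<and>
    (\<forall>v\<in>pos_kroots n k. \<exists>T (c :: qpoly \<Rightarrow> nat). finite T \<and> T \<subseteq> B n k \<and>
       v = (\<Sum>u\<in>T. scaleQ (of_nat (c u)) u)) \<and>
    B n k = {v \<in> pos_kroots n k. \<not> pos_lin_comb v (pos_kroots n k - {v})}"
proof (intro conjI ballI)
  show "bij_betw (label n k) (B n k) (lattice_words n k)"
    by (rule bij_betw_label[OF assms(2)])
  show "B n k \<subseteq> V n k" by (rule B_subset_V)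
  show "qpoly.independent (B n k)" by (rule independent_B[OF assms(2)])
  have "qpoly.span (B n k) \<subseteq> V n k"
    using B_subset_V unfolding V_def by (intro qpoly.span_minimal qpoly.subspace_span)
  then show "qpoly.span (B n k) = V n k"
    using V_subset_span_B[OF assms(2)] by blast
  show "\<exists>T (c :: qpoly \<Rightarrow> nat). finite T \<and> T \<subseteq> B n k \<and> v = (\<Sum>u\<in>T. scaleQ (of_nat (c u)) u)"
    if "v \<in> pos_kroots n k" for v
  proof -
    from that obtain F where F: "matching n F" "card F = k" "v = fprod F" by (auto simp: pos_kroots_eq)
    then obtain c :: "qpoly \<Rightarrow> nat" where "v = (\<Sum>u\<in>B n k. scaleQ (of_nat (c u)) u)"
      using fprod_nat_combination[OF F(1)] by blast
    then show ?thesis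
      using finite_B by (intro exI[of _ "B n k"] exI[of _ c]) simp
  qed
  show "B n k = {v \<in> pos_kroots n k. \<not> pos_lin_comb v (pos_kroots n k - {v})}"
  proof (intro set_eqI iffI CollectI conjI)
    fix v assume v: "v \<in> B n k"
    then show "v \<in> pos_kroots n k" by (simp add: B_def)
    show "\<not> pos_lin_comb v (pos_kroots n k - {v})"
      by (rule B_not_pos_lin_comb[OF assms(2) v])
  next
    fix v assume v: "v \<in> {v \<in> pos_kroots n k. \<not> pos_lin_comb v (pos_kroots n k - {v})}"
    then obtain F where F: "matching n F" "card F = k" "v = fprod F" by (auto simp: pos_kroots_eq)
    then have "\<not> defect n F"
      using v defect_imp_pos_lin_comb by blast
    then show "v \<in> B n k" using F by (auto simp: B_eq)
  qed
qed

end
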